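(* Let $d\in\mathbb{N}$, $a>0$, and let $\kappa$ be a nonnegative multiplicity function on a root system in $\mathbb{R}^d$ with $2\lambda_\kappa+a>0$. (i) If $\mathcal{F}_{\kappa,a}(\mathcal{S}(\mathbb{R}^d))\subset C^\infty(\mathbb{R}^d)$, then $\frac a2\in\mathbb{N}$. (ii) If every function in $\mathcal{F}_{\kappa,a}(\mathcal{S}(\mathbb{R}^d))$ is rapidly decreasing at infinity, then $\frac2a\in\mathbb{N}$.
   Context: $\mathcal{S}(\mathbb{R}^d)$ is the Schwartz space. A function $h$ is rapidly decreasing at infinity if $|y|^N h(y)\to0$ as $|y|\to\infty$ for every $N\in\mathbb{N}$. Functions in $L^2$ are identified with their continuous representatives when these exist. $\Omega\subset\mathbb{R}^d\setminus\{0\}$ is a root system, $\sigma_\alpha$ the reflection in the hyperplane orthogonal to $\alpha$, $G$ the finite group generated by the $\sigma_\alpha$, $\alpha\in\Omega$, and $\kappa:\Omega\to[0,\infty)$ is $G$-invariant. Put $\langle\kappa\rangle=\frac12\sum_{\alpha\in\Omega}\kappa(\alpha)$, $\lambda_\kappa=\langle\kappa\rangle+\frac{d-2}2$, $\lambda_{\kappa,a}=2\lambda_\kappa/a$ (for $d=1$, $\kappa$ is identified with the number $\langle\kappa\rangle$). Let $v_\kappa(x)=\prod_{\alpha\in\Omega}|\langle\alpha,x\rangle|^{\kappa(\alpha)}$, $v_{\kappa,a}(x)=|x|^{a-2}v_\kappa(x)$, $d\mu_{\kappa,a}(x)=c_{\kappa,a}v_{\kappa,a}(x)\,dx$ with $c_{\kappa,a}^{-1}=\int_{\mathbb{R}^d}e^{-|x|^a/a}v_{\kappa,a}(x)\,dx$.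 Dunkl operators: $T_\xi f(x)=\partial_\xi f(x)+\frac12\sum_{\alpha\in\Omega}\kappa(\alpha)\langle\alpha,\xi\rangle\frac{f(x)-f(\sigma_\alpha x)}{\langle\alpha,x\rangle}$; Dunkl Laplacian $\Delta_\kappa=\sum_{i=1}^dT_{e_i}^2$; $\Delta_{\kappa,a}=|x|^{2-a}\Delta_\kappa-|x|^a$. The $(\kappa,a)$-generalized Fourier transform is the unitary operator on $L^2(\mathbb{R}^d,d\mu_{\kappa,a})$ $$\mathcal{F}_{\kappa,a}=\exp\Bigl(\tfrac{i\pi}{2}(\lambda_{\kappa,a}+1)\Bigr)\exp\Bigl(\tfrac{i\pi}{2a}\Delta_{\kappa,a}\Bigr).$$ Equivalently, it is the unitary operator determined by $\mathcal{F}_{\kappa,a}\Phi=e^{-i\pi(\ell+n/a)}\Phi$ for all $\Phi(x)=p(x)L_\ell^{(2(\lambda_\kappa+n)/a)}\bigl(\tfrac2a|x|^a\bigr)e^{-|x|^a/a}$, where $\ell,n\in\mathbb{Z}_+$, $p$ is a homogeneous polynomial of degree $n$ with $\Delta_\kappa p=0$, and $L_\ell^{(\nu)}$ is the Laguerre polynomial; such $\Phi$ span a dense subspace. It is an integral transform $\mathcal{F}_{\kappa,a}(f)(y)=\int_{\mathbb{R}^d}B_{\kappa,a}(x,y)f(x)\,d\mu_{\kappa,a}(x)$ with a continuous symmetric kernel satisfying $B_{\kappa,a}(0,y)=1$. *)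

theory Defs
  imports "HOL-Analysis.Analysis"
begin

section \<open>Smooth and Schwartz functions\<close>

text \<open>Iterated partial derivatives, along a list of directions.\<close>

fun iter_deriv :: "'a::real_normed_vector list \<Rightarrow> ('a \<Rightarrow> 'b::real_normed_vector) \<Rightarrow> 'a \<Rightarrow> 'b" where
  "iter_deriv [] f = f"
| "iter_deriv (v # vs) f = (\<lambda>x. frechet_derivative (iter_deriv vs f) (at x) v)"

text \<open>All iterated partial derivatives exist and are differentiable (hence continuous)
  everywhere; this is the usual class of infinitely differentiable functions.\<close>

definition smooth :: "('a::euclidean_space \<Rightarrow> 'b::real_normed_vector) \<Rightarrow> bool" where
  "smooth f \<longleftrightarrow> (\<forall>vs x. set vs \<subseteq> Basis \<longrightarrow> iter_deriv vs f differentiable (at x))"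

definition schwartz :: "('a::euclidean_space \<Rightarrow> complex) set" where
  "schwartz = {f. smooth f \<and>
     (\<forall>N vs. set vs \<subseteq> Basis \<longrightarrow> bounded (range (\<lambda>x. norm x ^ N *\<^sub>R iter_deriv vs f x)))}"

definition rapidly_decreasing :: "('a::real_normed_vector \<Rightarrow> complex) \<Rightarrow> bool" where
  "rapidly_decreasing h \<longleftrightarrow> (\<forall>N. ((\<lambda>y. norm y ^ N *\<^sub>R h y) \<longlongrightarrow> 0) at_infinity)"

section \<open>Root systems and multiplicity functions\<close>

definition reflection :: "'a::real_inner \<Rightarrow> 'a \<Rightarrow> 'a" where
  "reflection \<alpha> x = x - (2 * (\<alpha> \<bullet> x) / (\<alpha> \<bullet> \<alpha>)) *\<^sub>R \<alpha>"

text \<open>As usual in Dunkl theory, no crystallographic condition is imposed, and the roots need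
  not span the space. Being reduced is not demanded either.\<close>

definition root_system :: "'a::euclidean_space set \<Rightarrow> bool" where
  "root_system \<Omega> \<longleftrightarrow> finite \<Omega> \<and> 0 \<notin> \<Omega> \<and> (\<forall>\<alpha>\<in>\<Omega>. reflection \<alpha> ` \<Omega> = \<Omega>)"

text \<open>Reflections are involutions, so the monoid they generate is a group.\<close>

inductive_set reflection_group :: "'a::euclidean_space set \<Rightarrow> ('a \<Rightarrow> 'a) set" for \<Omega> where
  "id \<in> reflection_group \<Omega>"
| "\<alpha> \<in> \<Omega> \<Longrightarrow> g \<in> reflection_group \<Omega> \<Longrightarrow> reflection \<alpha> \<circ> g \<in> reflection_group \<Omega>"

definition multiplicity_function :: "'a::euclidean_space set \<Rightarrow> ('a \<Rightarrow> real) \<Rightarrow> bool" where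
  "multiplicity_function \<Omega> \<kappa> \<longleftrightarrow>
     (\<forall>\<alpha>\<in>\<Omega>. 0 \<le> \<kappa> \<alpha>) \<and> (\<forall>g\<in>reflection_group \<Omega>. \<forall>\<alpha>\<in>\<Omega>. \<kappa> (g \<alpha>) = \<kappa> \<alpha>)"

definition lambda :: "'a::euclidean_space set \<Rightarrow> ('a \<Rightarrow> real) \<Rightarrow> real" where
  "lambda \<Omega> \<kappa> = (1/2) * (\<Sum>\<alpha>\<in>\<Omega>. \<kappa> \<alpha>) + (real DIM('a) - 2) / 2"

section \<open>The weighted measure and its $L^2$ space\<close>

text \<open>Since \<open>0 powr s = 0\<close> for every \<open>s\<close>, including \<open>s = 0\<close>, the value of the weight on the
  reflecting hyperplanes and at the origin may be off; this is a null set.\<close>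

definition weight :: "'a::euclidean_space set \<Rightarrow> ('a \<Rightarrow> real) \<Rightarrow> real \<Rightarrow> 'a \<Rightarrow> real" where
  "weight \<Omega> \<kappa> a x = norm x powr (a - 2) * (\<Prod>\<alpha>\<in>\<Omega>. \<bar>\<alpha> \<bullet> x\<bar> powr \<kappa> \<alpha>)"

definition norm_const :: "'a::euclidean_space set \<Rightarrow> ('a \<Rightarrow> real) \<Rightarrow> real \<Rightarrow> real" where
  "norm_const \<Omega> \<kappa> a =
     inverse (LINT x|lborel. exp (- (norm x powr a) / a) * weight \<Omega> \<kappa> a x)"

definition mu :: "'a::euclidean_space set \<Rightarrow> ('a \<Rightarrow> real) \<Rightarrow> real \<Rightarrow> 'a measure" where
  "mu \<Omega> \<kappa> a = density lborel (\<lambda>x. ennreal (norm_const \<Omega> \<kappa> a * weight \<Omega> \<kappa> a x))"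

definition L2 :: "'a measure \<Rightarrow> ('a \<Rightarrow> complex) set" where
  "L2 M = {f. f \<in> borel_measurable M \<and> integrable M (\<lambda>x. (cmod (f x))\<^sup>2)}"

text \<open>Elements of \<open>L\<^sup>2\<close> are represented by functions, so an operator is a map on functions that
  respects equality almost everywhere, and all identities hold almost everywhere.\<close>

definition unitary_operator :: "'a measure \<Rightarrow> (('a \<Rightarrow> complex) \<Rightarrow> 'a \<Rightarrow> complex) \<Rightarrow> bool" where
  "unitary_operator M F \<longleftrightarrow>
     (\<forall>f\<in>L2 M. F f \<in> L2 M) \<and>
     (\<forall>f\<in>L2 M. \<forall>g\<in>L2 M. (AE x in M. f x = g x) \<longrightarrow> (AE x in M. F f x = F g x)) \<and>
     (\<forall>f\<in>L2 M. \<forall>g\<in>L2 M. \<forall>c. AE x in M. F (\<lambda>y. c * f y + g y) x = c * F f x + F g x) \<and>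
     (\<forall>f\<in>L2 M. \<forall>g\<in>L2 M.
        (LINT x|M. F f x * cnj (F g x)) = (LINT x|M. f x * cnj (g x))) \<and>
     (\<forall>g\<in>L2 M. \<exists>f\<in>L2 M. AE x in M. F f x = g x)"

section \<open>Dunkl operators\<close>

text \<open>On the hyperplane orthogonal to \<open>\<alpha>\<close> the difference quotient is defined by its continuous
  extension \<open>(2 / |\<alpha>|\<^sup>2) \<partial>\<^sub>\<alpha> f(x)\<close>, rather than by the convention \<open>u / 0 = 0\<close>.\<close>

definition dunkl_quotient ::
    "'a::euclidean_space \<Rightarrow> ('a \<Rightarrow> complex) \<Rightarrow> 'a \<Rightarrow> complex" where
  "dunkl_quotient \<alpha> f x =
     (if \<alpha> \<bullet> x = 0 then (2 / (\<alpha> \<bullet> \<alpha>)) *\<^sub>R frechet_derivative f (at x) \<alpha>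
      else (f x - f (reflection \<alpha> x)) /\<^sub>R (\<alpha> \<bullet> x))"

definition dunkl ::
    "'a::euclidean_space set \<Rightarrow> ('a \<Rightarrow> real) \<Rightarrow> 'a \<Rightarrow> ('a \<Rightarrow> complex) \<Rightarrow> 'a \<Rightarrow> complex" where
  "dunkl \<Omega> \<kappa> \<xi> f x = frechet_derivative f (at x) \<xi>
     + (1/2) * (\<Sum>\<alpha>\<in>\<Omega>. (\<kappa> \<alpha> * (\<alpha> \<bullet> \<xi>)) *\<^sub>R dunkl_quotient \<alpha> f x)"

definition dunkl_laplacian ::
    "'a::euclidean_space set \<Rightarrow> ('a \<Rightarrow> real) \<Rightarrow> ('a \<Rightarrow> complex) \<Rightarrow> 'a \<Rightarrow> complex" where
  "dunkl_laplacian \<Omega> \<kappa> f x = (\<Sum>e\<in>Basis. dunkl \<Omega> \<kappa> e (dunkl \<Omega> \<kappa> e f) x)"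

definition homogeneous_polynomial :: "nat \<Rightarrow> ('a::euclidean_space \<Rightarrow> complex) \<Rightarrow> bool" where
  "homogeneous_polynomial n p \<longleftrightarrow>
     polynomial_function p \<and> (\<forall>t x. p (t *\<^sub>R x) = t ^ n *\<^sub>R p x)"

section \<open>The generalized Fourier transform\<close>

definition laguerre :: "nat \<Rightarrow> real \<Rightarrow> real \<Rightarrow> real" where
  "laguerre l \<nu> t =
     (\<Sum>j\<le>l. (-1) ^ j * ((real l + \<nu>) gchoose (l - j)) * t ^ j / fact j)"

definition Phi :: "'a::euclidean_space set \<Rightarrow> ('a \<Rightarrow> real) \<Rightarrow> real \<Rightarrow> nat \<Rightarrow> nat
    \<Rightarrow> ('a \<Rightarrow> complex) \<Rightarrow> 'a \<Rightarrow> complex" where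
  "Phi \<Omega> \<kappa> a l n p x =
     p x * of_real (laguerre l (2 * (lambda \<Omega> \<kappa> + real n) / a) ((2 / a) * norm x powr a)
                    * exp (- (norm x powr a) / a))"

text \<open>The functions \<open>Phi\<close> with \<open>p\<close> a homogeneous Dunkl-harmonic polynomial have dense span, so
  this determines \<open>F\<close> up to equality almost everywhere. They are eigenfunctions of
  \<open>|x|\<^bsup>2-a\<^esup> \<Delta>\<^sub>\<kappa> - |x|\<^bsup>a\<^esup>\<close> with eigenvalue \<open>-2 a l - 2 n - 2 \<lambda>\<^sub>\<kappa> - a\<close>, so \<open>F\<close> is
  \<open>exp (i \<pi> (\<lambda>\<^sub>\<kappa>\<^sub>,\<^sub>a + 1) / 2)\<close> times \<open>exp (i \<pi> D / (2 a))\<close>, where \<open>D\<close> is that operator.\<close>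

definition gen_fourier_transform :: "'a::euclidean_space set \<Rightarrow> ('a \<Rightarrow> real) \<Rightarrow> real
    \<Rightarrow> (('a \<Rightarrow> complex) \<Rightarrow> 'a \<Rightarrow> complex) \<Rightarrow> bool" where
  "gen_fourier_transform \<Omega> \<kappa> a F \<longleftrightarrow>
     unitary_operator (mu \<Omega> \<kappa> a) F \<and>
     (\<forall>l n p. homogeneous_polynomial n p \<and> (\<forall>x. dunkl_laplacian \<Omega> \<kappa> p x = 0) \<longrightarrow>
        (AE x in mu \<Omega> \<kappa> a. F (Phi \<Omega> \<kappa> a l n p) x =
           exp (- \<i> * of_real (pi * (real l + real n / a))) * Phi \<Omega> \<kappa> a l n p x))"

end

theory Submission
  imports Defs "HOL-Complex_Analysis.Complex_Analysis"
begin

text \<open>Write \<open>u = |x|\<^sup>a / a\<close>, \<open>\<nu> = 2 \<lambda>\<^sub>\<kappa> / a\<close>, let \<open>f\<close> be the Gaussian \<open>exp (- |x|\<^sup>2)\<close> and \<open>g = F f\<close>. Testing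
  unitarity against the radial eigenfunctions and summing with the Laguerre generating function gives
  \<open>\<integral> g exp (- s u) d\<mu> = s powr (- \<nu> - 1) * \<integral> f exp (- u / s) d\<mu>\<close> for all \<open>s > 0\<close>; no kernel of \<open>F\<close> is needed.
  The measure is homogeneous, so a Taylor expansion at 0 of \<open>g\<close> (or \<open>f\<close>) turns the corresponding integral
  into an expansion in even powers of \<open>s powr (- 1 / a)\<close> (or \<open>s powr (1 / a)\<close>), whereas moments turn it
  into one in integer powers of \<open>1 / s\<close> (or \<open>s\<close>).
  If \<open>g\<close> is smooth, let \<open>s\<close> tend to infinity: the term with the positive moment \<open>\<integral> f u d\<mu>\<close>, of order \<open>1 / s\<close>,
  must match an even power of \<open>s powr (- 1 / a)\<close>, so \<open>a\<close> is even.
  If \<open>g\<close> is rapidly decreasing, let \<open>s\<close> tend to 0: the quadratic term of \<open>f\<close>, of order \<open>s powr (2 / a)\<close>,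
  must match an integer power of \<open>s\<close>.\<close>

section \<open>Laguerre expansions and Laplace transforms\<close>

text \<open>\<open>F\<close> is given only by its eigenfunctions and only up to null sets, so
  \<open>F f\<close> is probed by its pairings with the radial ones (\<open>p = 1\<close>). Their
  eigenvalue \<open>(-1) ^ l\<close> is real and free of \<open>a\<close>: applying \<open>F\<close>
  changes \<open>z\<close> to \<open>- z\<close> in the generating function, which is where
  \<open>s\<close> becomes \<open>1 / s\<close>, and real parts may be taken throughout. The
  obstacle is that termwise integration is under control only for
  \<open>\<bar>z\<bar> < 1 / 3\<close>, that is \<open>1 / 2 < s < 2\<close>, while the asymptotics
  live at 0 and infinity. The Gaussian is Schwartz for every \<open>a\<close>, whereas
  \<open>exp (- u)\<close> may fail to be smooth at 0 and is moreover fixed by \<open>F\<close>. Its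
  positivity keeps the decisive moment in the smooth case from vanishing, and its nonzero quadratic
  coefficient does the same in the other case; both times the surviving term is isolated by a
  sign.\<close>

lemma dominated_sums_integral:
  fixes f :: "nat \<Rightarrow> 'a \<Rightarrow> 'b::{banach, second_countable_topology}"
  assumes f: "\<And>n. f n \<in> borel_measurable M" and S: "S \<in> borel_measurable M"
    and sums: "\<And>x. (\<lambda>n. f n x) sums S x"
    and bound: "\<And>n x. (\<Sum>i<n. norm (f i x)) \<le> w x"
    and w: "integrable M w"
  shows "(\<lambda>n. integral\<^sup>L M (f n)) sums integral\<^sup>L M S"
proof -
  have "norm (f n x) \<le> w x" for n x
    using bound[of x "Suc n"] sum_nonneg[of "{..<n}" "\<lambda>i. norm (f i x)"] by auto
  then have int: "integrable M (f n)" for n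
    using w f by (intro Bochner_Integration.integrable_bound[OF w]) (auto intro: order_trans[OF _ abs_ge_self])
  have "(\<lambda>n. \<integral>x. (\<Sum>i<n. f i x) \<partial>M) \<longlonglongrightarrow> integral\<^sup>L M S"
    using f S w sums
    by (intro integral_dominated_convergence[where w = w])
       (auto simp: sums_def intro!: order_trans[OF norm_sum bound])
  then show ?thesis
    using int by (simp add: sums_def)
qed

text \<open>Newton's binomial series with exponent \<open>- x - 1\<close> at \<open>- z\<close>;
  negating the upper index produces the coefficients that occur in Laguerre polynomials.\<close>

lemma gbinomial_sums_powr:
  fixes x z :: real
  assumes "\<bar>z\<bar> < 1"
  shows "(\<lambda>m. ((real m + x) gchoose m) * z ^ m) sums (1 - z) powr (- x - 1)"
proof -
  have "(- x - 1 gchoose m) * (- z) ^ m = ((real m + x) gchoose m) * z ^ m" for m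
  proof -
    have "(- x - 1 gchoose m) = (- 1) ^ m * ((real m + x) gchoose m)"
    proof -
      have eq: "- x - 1 = - (x + 1)"
        by simp
      show ?thesis
        unfolding eq gbinomial_minus by (simp add: add.commute)
    qed
    then show ?thesis
      by (simp add: power_mult_distrib[symmetric] mult.assoc mult.left_commute)
  qed
  then show ?thesis
    using gen_binomial_real[of "- z" "- x - 1"] assms by simp
qed

text \<open>The numerator is the product of \<open>x + 1\<close> up to \<open>x + m\<close>, all
  positive. This sign is why absolute values of Laguerre series are again Laguerre series, at a
  negative argument.\<close>

lemma gbinomial_nonneg_shift:
  fixes x :: real
  assumes "x > - 1"
  shows "0 \<le> (real m + x) gchoose m"
  using assms by (auto simp: gbinomial_prod_rev intro!: divide_nonneg_pos prod_nonneg)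

text \<open>With \<open>l = j + m\<close> the series becomes a double series: the sum over
  \<open>m\<close> is a binomial series with value \<open>(1 - z) powr (- (j + \<nu>) - 1)\<close>,
  and what remains over \<open>j\<close> is an exponential series in
  \<open>- t * z / (1 - z)\<close>. Summability follows from the same two evaluations at
  \<open>- \<bar>t\<bar>\<close> and \<open>\<bar>z\<bar>\<close>, where the terms are the absolute
  values.\<close>

lemma laguerre_generating_function:
  fixes \<nu> t z :: real
  assumes "\<nu> > - 1" and z: "\<bar>z\<bar> < 1"
  shows "(\<lambda>l. laguerre l \<nu> t * z ^ l) sums ((1 - z) powr (- \<nu> - 1) * exp (- t * z / (1 - z)))"
proof -
  define c where "c t z = (\<lambda>(j, m). (- t * z) ^ j / fact j *
      (((real m + (real j + \<nu>)) gchoose m) * z ^ m))" for t z :: real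
  have inner: "((\<lambda>m. c t z (j, m)) has_sum
      ((- t * z / (1 - z)) ^ j / fact j * (1 - z) powr (- \<nu> - 1))) UNIV" if "\<bar>z\<bar> < 1" for t z j
  proof -
    have a: "(\<lambda>m. ((real m + (real j + \<nu>)) gchoose m) * z ^ m) sums
        (1 - z) powr (- (real j + \<nu>) - 1)"
      using gbinomial_sums_powr that by blast
    have "(\<lambda>m. norm (((real m + (real j + \<nu>)) gchoose m) * z ^ m)) =
        (\<lambda>m. ((real m + (real j + \<nu>)) gchoose m) * \<bar>z\<bar> ^ m)"
      using gbinomial_nonneg_shift[of "real j + \<nu>"] assms by (auto simp: abs_mult power_abs)
    then have "summable (\<lambda>m. norm (((real m + (real j + \<nu>)) gchoose m) * z ^ m))"
      using gbinomial_sums_powr[of "\<bar>z\<bar>" "real j + \<nu>"] that by (simp add: sums_iff)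
    then have "((\<lambda>m. ((real m + (real j + \<nu>)) gchoose m) * z ^ m) has_sum
        (1 - z) powr (- (real j + \<nu>) - 1)) UNIV"
      using a by (rule norm_summable_imp_has_sum)
    then have "((\<lambda>m. c t z (j, m)) has_sum
        ((- t * z) ^ j / fact j * (1 - z) powr (- (real j + \<nu>) - 1))) UNIV"
      unfolding c_def prod.case by (rule has_sum_cmult_right)
    moreover have "(1 - z) powr (- (real j + \<nu>) - 1) = (1 - z) powr (- \<nu> - 1) / (1 - z) ^ j"
      using that by (simp add: powr_diff powr_minus powr_add powr_realpow field_simps)
    moreover have "(- t * z) ^ j / fact j * ((1 - z) powr (- \<nu> - 1) / (1 - z) ^ j) =
        (- t * z / (1 - z)) ^ j / fact j * (1 - z) powr (- \<nu> - 1)"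
      unfolding power_divide by simp
    ultimately show ?thesis
      by (simp only:)
  qed
  have outer: "((\<lambda>j. (- t * z / (1 - z)) ^ j / fact j * (1 - z) powr (- \<nu> - 1)) has_sum
      ((1 - z) powr (- \<nu> - 1) * exp (- t * z / (1 - z)))) UNIV" for t z
  proof -
    have "(\<lambda>j. (- t * z / (1 - z)) ^ j / fact j) sums exp (- t * z / (1 - z))"
      using exp_converges[of "- t * z / (1 - z)"] by (simp add: field_simps)
    moreover have "summable (\<lambda>j. norm ((- t * z / (1 - z)) ^ j / fact j))"
      using summable_norm_exp[of "- t * z / (1 - z)"] by (simp add: field_simps)
    ultimately have "((\<lambda>j. (- t * z / (1 - z)) ^ j / fact j) has_sum exp (- t * z / (1 - z))) UNIV"
      by (intro norm_summable_imp_has_sum)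
    then have "((\<lambda>j. (- t * z / (1 - z)) ^ j / fact j * (1 - z) powr (- \<nu> - 1)) has_sum
        (exp (- t * z / (1 - z)) * (1 - z) powr (- \<nu> - 1))) UNIV"
      by (rule has_sum_cmult_left)
    then show ?thesis
      by (simp only: mult.commute)
  qed
  have norm_c: "norm (c t z p) = c (- \<bar>t\<bar>) \<bar>z\<bar> p" for p
    using gbinomial_nonneg_shift[of "real (fst p) + \<nu>" "snd p"] assms
    by (auto simp: c_def case_prod_beta abs_mult power_abs)
  have "(\<lambda>p. norm (c t z p)) summable_on UNIV \<times> UNIV"
  proof -
    have inner': "((\<lambda>m. c (- \<bar>t\<bar>) \<bar>z\<bar> (j, m)) has_sum
        ((\<bar>t\<bar> * \<bar>z\<bar> / (1 - \<bar>z\<bar>)) ^ j / fact j * (1 - \<bar>z\<bar>) powr (- \<nu> - 1))) UNIV" for j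
      using inner[of "\<bar>z\<bar>" "- \<bar>t\<bar>" j] z by simp
    have "(\<lambda>j. norm ((\<bar>t\<bar> * \<bar>z\<bar> / (1 - \<bar>z\<bar>)) ^ j / fact j * (1 - \<bar>z\<bar>) powr (- \<nu> - 1))) =
        (\<lambda>j. (\<bar>t\<bar> * \<bar>z\<bar> / (1 - \<bar>z\<bar>)) ^ j / fact j * (1 - \<bar>z\<bar>) powr (- \<nu> - 1))"
      using z by (intro ext) (simp add: abs_mult)
    then show ?thesis
      unfolding Infinite_Sum.abs_summable_on_Sigma_iff unfolding norm_c infsumI[OF inner']
      using has_sum_imp_summable[OF inner'] has_sum_imp_summable[OF outer[of "- \<bar>t\<bar>" "\<bar>z\<bar>"]]
      by simp
  qed
  then have "c t z summable_on UNIV \<times> UNIV"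
    by (rule Infinite_Sum.abs_summable_summable)
  then have "(c t z has_sum ((1 - z) powr (- \<nu> - 1) * exp (- t * z / (1 - z)))) (UNIV \<times> UNIV)"
    by (intro has_sum_SigmaI[OF inner[OF z] outer])
  \<comment> \<open>Regrouping along diagonals: \<open>(l, j)\<close> with \<open>j \<le> l\<close>
    stands for \<open>(j, m)\<close> with \<open>m = l - j\<close>, so the natural-number
    subtraction is exact.\<close>
  then have "((\<lambda>(l, j). c t z (j, l - j)) has_sum
      ((1 - z) powr (- \<nu> - 1) * exp (- t * z / (1 - z)))) (SIGMA l:UNIV. {..l})"
    by (subst has_sum_reindex_bij_witness[where T = "UNIV \<times> UNIV" and h = "c t z"
          and j = "\<lambda>(l, j). (j, l - j)" and i = "\<lambda>(j, m). (j + m, j)"]) auto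
  then have "((\<lambda>l. laguerre l \<nu> t * z ^ l) has_sum
      ((1 - z) powr (- \<nu> - 1) * exp (- t * z / (1 - z)))) UNIV"
  proof (rule has_sum_SigmaD)
    fix l :: nat
    have "laguerre l \<nu> t * z ^ l = (\<Sum>j\<le>l. c t z (j, l - j))"
      unfolding laguerre_def sum_distrib_right c_def
    proof (intro sum.cong refl)
      fix j assume "j \<in> {..l}"
      then have *: "z ^ l = z ^ j * z ^ (l - j)" "real (l - j) + (real j + \<nu>) = real l + \<nu>"
        by (auto simp flip: power_add)
      have "(- t * z) ^ j = (- 1) ^ j * t ^ j * z ^ j"
        by (metis mult_minus1 power_mult_distrib)
      then show "(- 1) ^ j * (real l + \<nu> gchoose (l - j)) * t ^ j / fact j * z ^ l =
         (case (j, l - j) of (j, m) \<Rightarrow> (- t * z) ^ j / fact j *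
           ((real m + (real j + \<nu>) gchoose m) * z ^ m))"
        unfolding * prod.case by simp
    qed
    then show "((\<lambda>j. case (l, j) of (l, j) \<Rightarrow> c t z (j, l - j)) has_sum laguerre l \<nu> t * z ^ l) {..l}"
      by (simp add: has_sum_finite)
  qed
  then show ?thesis
    by (rule has_sum_imp_sums)
qed

text \<open>The coefficient of \<open>t ^ j\<close> has the sign \<open>(-1) ^ j\<close>, so at
  \<open>- \<bar>t\<bar>\<close> nothing cancels.\<close>

lemma abs_laguerre_le:
  assumes "\<nu> > - 1"
  shows "\<bar>laguerre l \<nu> t\<bar> \<le> laguerre l \<nu> (- \<bar>t\<bar>)"
proof -
  have nonneg: "0 \<le> (real l + \<nu>) gchoose (l - j)" if "j \<le> l" for j
    using gbinomial_nonneg_shift[of "real j + \<nu>" "l - j"] assms that by (simp add: of_nat_diff)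
  have "\<bar>laguerre l \<nu> t\<bar> \<le>
      (\<Sum>j\<le>l. \<bar>(-1) ^ j * ((real l + \<nu>) gchoose (l - j)) * t ^ j / fact j\<bar>)"
    unfolding laguerre_def by (rule sum_abs)
  also have "\<dots> = laguerre l \<nu> (- \<bar>t\<bar>)"
    unfolding laguerre_def
    by (intro sum.cong refl)
       (simp add: abs_mult power_abs nonneg power_minus[of "\<bar>t\<bar>"] mult.commute)
  finally show ?thesis .
qed

text \<open>The series at \<open>- \<bar>t\<bar>\<close> has nonnegative terms and a known sum. The
  estimate serves as majorant for termwise integration and, through a single term, as growth bound
  for each Laguerre polynomial.\<close>

lemma sum_abs_laguerre_le:
  assumes "\<nu> > - 1" and z: "0 \<le> z" "z < 1"
  shows "(\<Sum>l<n. \<bar>laguerre l \<nu> t\<bar> * z ^ l) \<le> (1 - z) powr (- \<nu> - 1) * exp (\<bar>t\<bar> * z / (1 - z))"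
proof -
  have "(\<lambda>l. laguerre l \<nu> (- \<bar>t\<bar>) * z ^ l) sums ((1 - z) powr (- \<nu> - 1) * exp (\<bar>t\<bar> * z / (1 - z)))"
    using laguerre_generating_function[of \<nu> z "- \<bar>t\<bar>"] assms by simp
  moreover have le: "\<bar>laguerre l \<nu> t\<bar> * z ^ l \<le> laguerre l \<nu> (- \<bar>t\<bar>) * z ^ l" for l
    using abs_laguerre_le[of \<nu> l t] assms by (intro mult_right_mono) auto
  moreover have "0 \<le> laguerre l \<nu> (- \<bar>t\<bar>) * z ^ l" for l
    using z by (intro order_trans[OF _ le]) auto
  ultimately have "(\<Sum>l<n. laguerre l \<nu> (- \<bar>t\<bar>) * z ^ l) \<le>
      (1 - z) powr (- \<nu> - 1) * exp (\<bar>t\<bar> * z / (1 - z))"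
    using sum_le_suminf[of "\<lambda>l. laguerre l \<nu> (- \<bar>t\<bar>) * z ^ l" "{..<n}"]
    by (auto simp: sums_iff)
  moreover have "(\<Sum>l<n. \<bar>laguerre l \<nu> t\<bar> * z ^ l) \<le> (\<Sum>l<n. laguerre l \<nu> (- \<bar>t\<bar>) * z ^ l)"
    by (intro sum_mono le)
  ultimately show ?thesis
    by linarith
qed

section \<open>Termwise integration and Laplace transforms in the variable \<open>u\<close>\<close>

lemma laguerre_measurable [measurable]: "laguerre l \<nu> \<in> borel_measurable borel"
  unfolding laguerre_def[abs_def] by measurable

text \<open>At \<open>t = 2 * u\<close> the exponential in the generating function merges with
  \<open>exp (- u)\<close> into \<open>exp (- s * u)\<close> for
  \<open>s = (1 + z) / (1 - z)\<close>. This Cayley map links Laguerre coefficients with Laplace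
  transforms.\<close>

lemma laguerre_transform_sums:
  fixes g u :: "'a \<Rightarrow> real"
  assumes \<nu>: "\<nu> > - 1" and [measurable]: "g \<in> borel_measurable M" "u \<in> borel_measurable M"
    and u: "\<And>x. 0 \<le> u x"
    and int: "\<And>s. s > 0 \<Longrightarrow> integrable M (\<lambda>x. g x * exp (- s * u x))"
    and z: "\<bar>z\<bar> < 1 / 3"
  shows "(\<lambda>l. z ^ l * (LINT x|M. g x * (laguerre l \<nu> (2 * u x) * exp (- u x)))) sums
    ((1 - z) powr (- \<nu> - 1) * (LINT x|M. g x * exp (- ((1 + z) / (1 - z)) * u x)))"
proof -
  \<comment> \<open>The majorant grows like
    \<open>exp (2 * u * \<bar>z\<bar> / (1 - \<bar>z\<bar>))\<close>; against
    \<open>exp (- u)\<close> the decay rate \<open>\<epsilon>\<close> remains, positive exactly for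
    \<open>\<bar>z\<bar> < 1 / 3\<close>.\<close>
  define \<epsilon> where "\<epsilon> = 1 - 2 * \<bar>z\<bar> / (1 - \<bar>z\<bar>)"
  have "\<epsilon> > 0"
    using z by (auto simp: \<epsilon>_def field_simps)
  define w where "w x = (1 - \<bar>z\<bar>) powr (- \<nu> - 1) * \<bar>g x * exp (- \<epsilon> * u x)\<bar>" for x
  have w: "integrable M w"
    unfolding w_def using int[OF \<open>\<epsilon> > 0\<close>] by (intro integrable_mult_right integrable_abs)
  have "(\<lambda>l. LINT x|M. z ^ l * (g x * (laguerre l \<nu> (2 * u x) * exp (- u x)))) sums
      (LINT x|M. (1 - z) powr (- \<nu> - 1) * (g x * exp (- ((1 + z) / (1 - z)) * u x)))"
  proof (rule dominated_sums_integral[OF _ _ _ _ w])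
    fix x
    have "(\<lambda>l. (laguerre l \<nu> (2 * u x) * z ^ l) * (g x * exp (- u x))) sums
        ((1 - z) powr (- \<nu> - 1) * exp (- (2 * u x) * z / (1 - z)) * (g x * exp (- u x)))"
      using z by (intro sums_mult2 laguerre_generating_function \<nu>) auto
    moreover have "(1 - z) powr (- \<nu> - 1) * exp (- (2 * u x) * z / (1 - z)) * (g x * exp (- u x)) =
        (1 - z) powr (- \<nu> - 1) * (g x * exp (- ((1 + z) / (1 - z)) * u x))"
    proof -
      have "exp (- (2 * u x) * z / (1 - z)) * exp (- u x) = exp (- ((1 + z) / (1 - z)) * u x)"
        using z by (simp flip: exp_add add: field_simps)
      then show ?thesis
        by (metis mult.assoc mult.left_commute)
    qed
    moreover have "(laguerre l \<nu> (2 * u x) * z ^ l) * (g x * exp (- u x)) =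
        z ^ l * (g x * (laguerre l \<nu> (2 * u x) * exp (- u x)))" for l
      by simp
    ultimately show "(\<lambda>l. z ^ l * (g x * (laguerre l \<nu> (2 * u x) * exp (- u x)))) sums
        ((1 - z) powr (- \<nu> - 1) * (g x * exp (- ((1 + z) / (1 - z)) * u x)))"
      by (simp only:)
    fix n
    have "(\<Sum>l<n. norm (z ^ l * (g x * (laguerre l \<nu> (2 * u x) * exp (- u x))))) =
        (\<Sum>l<n. \<bar>laguerre l \<nu> (2 * u x)\<bar> * \<bar>z\<bar> ^ l) * \<bar>g x * exp (- u x)\<bar>"
      unfolding sum_distrib_right by (intro sum.cong refl) (simp add: abs_mult power_abs)
    also have "\<dots> \<le> (1 - \<bar>z\<bar>) powr (- \<nu> - 1) * exp (2 * u x * \<bar>z\<bar> / (1 - \<bar>z\<bar>)) * \<bar>g x * exp (- u x)\<bar>"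
      using sum_abs_laguerre_le[of \<nu> "\<bar>z\<bar>" "2 * u x" n] z \<nu> u[of x]
      by (intro mult_right_mono) auto
    also have "\<dots> = w x"
    proof -
      have "exp (2 * u x * \<bar>z\<bar> / (1 - \<bar>z\<bar>)) * exp (- u x) = exp (- \<epsilon> * u x)"
        by (simp flip: exp_add add: \<epsilon>_def algebra_simps)
      then show ?thesis
        by (simp add: w_def abs_mult mult_ac)
    qed
    finally show "(\<Sum>l<n. norm (z ^ l * (g x * (laguerre l \<nu> (2 * u x) * exp (- u x))))) \<le> w x" .
  qed measurable
  then show ?thesis
    by simp
qed

text \<open>Expanding \<open>exp (- w * u)\<close> in powers of \<open>w - z\<close> and integrating
  termwise gives a power series about \<open>z\<close>. The majorant
  \<open>\<bar>g\<bar> * exp (- (Re z - norm (w - z)) * u)\<close> is integrable on the disc of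
  radius \<open>Re z\<close>, the largest one about \<open>z\<close> inside the half-plane.\<close>

lemma laplace_transform_holomorphic:
  fixes g u :: "'a \<Rightarrow> real"
  assumes [measurable]: "g \<in> borel_measurable M" "u \<in> borel_measurable M"
    and u: "\<And>x. 0 \<le> u x"
    and int: "\<And>s. s > 0 \<Longrightarrow> integrable M (\<lambda>x. g x * exp (- s * u x))"
  shows "(\<lambda>s. LINT x|M. of_real (g x) * exp (- s * of_real (u x)) :: complex)
    holomorphic_on {s. Re s > 0}" (is "?\<phi> holomorphic_on ?H")
proof -
  have "?\<phi> holomorphic_on ball z (Re z)" if z: "z \<in> ?H" for z
  proof (rule power_series_holomorphic)
    fix w assume "w \<in> ball z (Re z)"
    then have "norm (w - z) < Re z"
      by (simp add: dist_norm norm_minus_commute)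
    then have w: "integrable M (\<lambda>x. \<bar>g x * exp (- (Re z - norm (w - z)) * u x)\<bar>)"
      using int[of "Re z - norm (w - z)"] by (intro integrable_abs) auto
    have "(\<lambda>n. LINT x|M. of_real (g x) * exp (- z * of_real (u x)) *
          ((- of_real (u x)) ^ n / fact n) * (w - z) ^ n) sums ?\<phi> w"
    proof (rule dominated_sums_integral[OF _ _ _ _ w])
      fix x
      have "(\<lambda>n. (of_real (g x) * exp (- z * of_real (u x))) * ((- of_real (u x) * (w - z)) ^ n /\<^sub>R fact n)) sums
          ((of_real (g x) * exp (- z * of_real (u x))) * exp (- of_real (u x) * (w - z)))"
        by (intro sums_mult exp_converges)
      moreover have "(of_real (g x) * exp (- z * of_real (u x))) * exp (- of_real (u x) * (w - z)) =
          of_real (g x) * exp (- w * of_real (u x))"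
        by (simp add: mult.assoc flip: exp_add) (simp add: algebra_simps)
      moreover have "(of_real (g x) * exp (- z * of_real (u x))) * ((- of_real (u x) * (w - z)) ^ n /\<^sub>R fact n) =
          of_real (g x) * exp (- z * of_real (u x)) * ((- of_real (u x)) ^ n / fact n) * (w - z) ^ n" for n
        unfolding power_mult_distrib by (simp add: scaleR_conv_of_real field_simps)
      ultimately show "(\<lambda>n. of_real (g x) * exp (- z * of_real (u x)) *
          ((- of_real (u x)) ^ n / fact n) * (w - z) ^ n) sums
          (of_real (g x) * exp (- w * of_real (u x)))"
        by (simp only:)
      fix n
      have "(\<Sum>i<n. norm (of_real (g x) * exp (- z * of_real (u x)) *
          ((- of_real (u x)) ^ i / fact i) * (w - z) ^ i)) =
          \<bar>g x\<bar> * exp (- Re z * u x) * (\<Sum>i<n. (u x * norm (w - z)) ^ i / fact i)"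
        unfolding sum_distrib_left using u[of x]
        by (intro sum.cong refl)
           (simp add: norm_mult norm_divide norm_power power_mult_distrib)
      also have "(\<Sum>i<n. (u x * norm (w - z)) ^ i / fact i) \<le> exp (u x * norm (w - z))"
        using exp_converges[of "u x * norm (w - z)"] u[of x]
          sum_le_suminf[of "\<lambda>i. (u x * norm (w - z)) ^ i / fact i" "{..<n}"]
        by (auto simp: sums_iff divide_inverse mult.commute)
      also have "\<bar>g x\<bar> * exp (- Re z * u x) * exp (u x * norm (w - z)) =
          \<bar>g x * exp (- (Re z - norm (w - z)) * u x)\<bar>"
        by (simp add: abs_mult mult.assoc flip: exp_add) (simp add: algebra_simps)
      finally show "(\<Sum>i<n. norm (of_real (g x) * exp (- z * of_real (u x)) *
          ((- of_real (u x)) ^ i / fact i) * (w - z) ^ i)) \<le>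
          \<bar>g x * exp (- (Re z - norm (w - z)) * u x)\<bar>"
        by (simp add: mult_left_mono)
    qed measurable
    then show "(\<lambda>n. (LINT x|M. of_real (g x) * exp (- z * of_real (u x)) *
          ((- of_real (u x)) ^ n / fact n)) * (w - z) ^ n) sums ?\<phi> w"
      by simp
  qed
  then have "?\<phi> analytic_on ?H"
    unfolding analytic_on_def by blast
  then show ?thesis
    by (rule analytic_imp_holomorphic)
qed

text \<open>By the generating function, the hypothesis gives the conclusion for \<open>s\<close> close to 1 in the form
  \<open>s = (1 + z) / (1 - z)\<close>, for which \<open>1 / s\<close> corresponds to \<open>- z\<close>; the general case is analytic
  continuation.\<close>

lemma laplace_transform_inversion_if_laguerre:
  fixes f g u :: "'a \<Rightarrow> real"
  assumes \<nu>: "\<nu> > - 1" and f [measurable]: "f \<in> borel_measurable M"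
    and g [measurable]: "g \<in> borel_measurable M" and u_meas [measurable]: "u \<in> borel_measurable M"
    and u: "\<And>x. 0 \<le> u x"
    and int_f: "\<And>s. s > 0 \<Longrightarrow> integrable M (\<lambda>x. f x * exp (- s * u x))"
    and int_g: "\<And>s. s > 0 \<Longrightarrow> integrable M (\<lambda>x. g x * exp (- s * u x))"
    and coeff: "\<And>l. (LINT x|M. g x * (laguerre l \<nu> (2 * u x) * exp (- u x))) =
        (-1) ^ l * (LINT x|M. f x * (laguerre l \<nu> (2 * u x) * exp (- u x)))"
    and s: "s > 0"
  shows "(LINT x|M. g x * exp (- s * u x)) =
    s powr (- \<nu> - 1) * (LINT x|M. f x * exp (- (1 / s) * u x))"
proof -
  \<comment> \<open>\<open>z = (s - 1) / (s + 1)\<close> maps this interval onto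
    \<open>\<bar>z\<bar> < 1 / 3\<close>, the range of termwise integration. The factor
    \<open>s powr (- \<nu> - 1)\<close> is the quotient of the two prefactors, by
    \<open>1 + z = s * (1 - z)\<close>.\<close>
  have near_1: "(LINT x|M. g x * exp (- s * u x)) =
    s powr (- \<nu> - 1) * (LINT x|M. f x * exp (- (1 / s) * u x))" if "s \<in> {1/2<..<2}" for s
  proof -
    define z where "z = (s - 1) / (s + 1)"
    have s: "1 / 2 < s" "s < 2"
      using that by auto
    then have z: "\<bar>z\<bar> < 1 / 3"
      by (auto simp: z_def field_simps abs_if)
    have z': "1 + z = 2 * s / (s + 1)" "1 - z = 2 / (s + 1)"
      using s by (auto simp: z_def field_simps)
    have zs: "(1 + z) / (1 - z) = s" "(1 - z) / (1 + z) = 1 / s"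
      using s by (simp_all add: z_def divide_simps)
    have "(\<lambda>l. z ^ l * (LINT x|M. g x * (laguerre l \<nu> (2 * u x) * exp (- u x)))) sums
        ((1 - z) powr (- \<nu> - 1) * (LINT x|M. g x * exp (- s * u x)))"
      using laguerre_transform_sums[OF \<nu> g u_meas u int_g z] by (simp add: zs)
    moreover have "(\<lambda>l. (- z) ^ l * (LINT x|M. f x * (laguerre l \<nu> (2 * u x) * exp (- u x)))) sums
        ((1 + z) powr (- \<nu> - 1) * (LINT x|M. f x * exp (- (1 / s) * u x)))"
      using laguerre_transform_sums[OF \<nu> f u_meas u int_f, of "- z"] z by (simp add: zs)
    moreover have "(- z) ^ l * (LINT x|M. f x * (laguerre l \<nu> (2 * u x) * exp (- u x))) =
        z ^ l * (LINT x|M. g x * (laguerre l \<nu> (2 * u x) * exp (- u x)))" for l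
      unfolding coeff by (simp add: power_minus[of z])
    ultimately have eq: "(1 - z) powr (- \<nu> - 1) * (LINT x|M. g x * exp (- s * u x)) =
        (1 + z) powr (- \<nu> - 1) * (LINT x|M. f x * exp (- (1 / s) * u x))"
      using sums_unique2 by (simp only:)
    have "(1 + z) powr (- \<nu> - 1) = s powr (- \<nu> - 1) * (1 - z) powr (- \<nu> - 1)"
      using z by (subst powr_mult[symmetric]) (simp_all flip: zs(1))
    then show ?thesis
      using eq z by auto
  qed
  \<comment> \<open>Both sides extend to complex \<open>s\<close> in the right half-plane, which is
    stable under inversion and avoids the cut of the principal power.\<close>
  define \<phi> where "\<phi> h s = (LINT x|M. of_real (h x) * exp (- s * of_real (u x)) :: complex)"
    for h :: "'a \<Rightarrow> real" and s
  define H where "H = {s. Re s > 0}"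
  have \<phi>_real: "\<phi> h (of_real s) = of_real (LINT x|M. h x * exp (- s * u x))" for h s
    unfolding \<phi>_def by (simp add: exp_of_real flip: of_real_mult of_real_minus)
  have \<phi>_hol [holomorphic_intros]: "\<phi> f holomorphic_on H" "\<phi> g holomorphic_on H"
    unfolding \<phi>_def H_def
    using laplace_transform_holomorphic[OF f u_meas u int_f]
      laplace_transform_holomorphic[OF g u_meas u int_g] by simp_all
  have "(\<phi> f \<circ> (\<lambda>s. 1 / s)) holomorphic_on H"
  proof (rule holomorphic_on_compose_gen[OF _ \<phi>_hol(1)])
    show "(\<lambda>s. 1 / s) holomorphic_on H"
      by (intro holomorphic_intros) (auto simp: H_def)
    show "(\<lambda>s. 1 / s) ` H \<subseteq> H"
      by (auto simp: H_def Re_divide intro!: divide_pos_pos add_pos_nonneg)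
  qed
  then have hol [holomorphic_intros]: "(\<lambda>s. \<phi> f (1 / s)) holomorphic_on H"
    by (simp add: o_def)
  have "\<phi> g (of_real s) - of_real s powr (- of_real \<nu> - 1) * \<phi> f (1 / of_real s) = 0"
  proof (rule analytic_continuation[where w = "of_real s" and S = H
        and f = "\<lambda>s. \<phi> g s - s powr (- of_real \<nu> - 1) * \<phi> f (1 / s)" and U = "of_real ` {1/2<..<2}" and \<xi> = 1])
    show "(\<lambda>s. \<phi> g s - s powr (- of_real \<nu> - 1) * \<phi> f (1 / s)) holomorphic_on H"
      by (intro holomorphic_intros) (auto simp: H_def complex_nonpos_Reals_iff)
    show "open H" "connected H"
      unfolding H_def by (auto intro: open_halfspace_Re_gt convex_connected convex_halfspace_Re_gt)
    have "(1::real) islimpt {1/2<..<2}"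
      by (rule islimpt_subset[OF islimpt_greaterThanLessThan1[of 1 2]]) auto
    then have "complex_of_real 1 islimpt of_real ` {1/2<..<2}"
      by (rule islimpt_isCont_image) (auto simp: eventually_at_filter)
    then show "(1::complex) islimpt of_real ` {1/2<..<2}"
      by simp
    fix z assume "z \<in> complex_of_real ` {1/2<..<2}"
    then obtain s :: real where s: "z = of_real s" "s \<in> {1/2<..<2}"
      by blast
    then have pw: "z powr (- of_real \<nu> - 1) = of_real (s powr (- \<nu> - 1))"
      using powr_of_real[of s "- \<nu> - 1"] by simp
    have "1 / z = of_real (1 / s)"
      by (simp add: s)
    then show "\<phi> g z - z powr (- of_real \<nu> - 1) * \<phi> f (1 / z) = 0"
      unfolding pw using near_1[OF s(2)] by (simp only: s(1) \<phi>_real flip: of_real_mult of_real_diff) simp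
  qed (use \<open>s > 0\<close> in \<open>auto simp: H_def\<close>)
  moreover have "of_real s powr (- of_real \<nu> - 1) = complex_of_real (s powr (- \<nu> - 1))"
    using powr_of_real[of s "- \<nu> - 1"] s by simp
  moreover have "1 / complex_of_real s = of_real (1 / s)"
    by simp
  ultimately have "of_real ((LINT x|M. g x * exp (- s * u x)) -
      s powr (- \<nu> - 1) * (LINT x|M. f x * exp (- (1 / s) * u x))) = (0 :: complex)"
    by (simp only: \<phi>_real flip: of_real_mult of_real_diff)
  then show ?thesis
    by (simp only: of_real_eq_0_iff)
qed

section \<open>Homogeneous weights\<close>

text \<open>For \<open>r > 1\<close>, choosing \<open>n\<close> with \<open>n * a \<ge> K\<close>
  bounds \<open>r ^ K\<close> by \<open>(r powr a) ^ n\<close>, and the single term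
  \<open>y ^ n / fact n\<close> of the series of \<open>exp y\<close> at
  \<open>y = s * r powr a\<close> absorbs it.\<close>

lemma exp_powr_decay:
  fixes a s :: real
  assumes "a > 0" "s > 0"
  shows "\<exists>C. \<forall>r\<ge>0. (1 + r) ^ K * exp (- s * r powr a) \<le> C"
proof -
  obtain n :: nat where n: "real K \<le> real n * a"
    using reals_Archimedean3[OF \<open>a > 0\<close>] by (metis less_le_not_le linorder_le_cases)
  have "(1 + r) ^ K * exp (- s * r powr a) \<le> 2 ^ K * (1 + fact n / s ^ n)" if "r \<ge> 0" for r
  proof (cases "r \<le> 1")
    case True
    have "(1 + r) ^ K * exp (- s * r powr a) \<le> 2 ^ K * 1"
      using True that assms by (intro mult_mono power_mono) auto
    also have "\<dots> \<le> 2 ^ K * (1 + fact n / s ^ n)"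
      using assms by simp
    finally show ?thesis .
  next
    case False
    define y where "y = s * r powr a"
    have y: "y \<ge> 0"
      using assms by (simp add: y_def)
    have "(1 + r) ^ K \<le> (2 * r) ^ K"
      using False by (intro power_mono) auto
    also have "\<dots> = 2 ^ K * r powr real K"
      using False by (simp add: power_mult_distrib powr_realpow)
    also have "r powr real K \<le> r powr (real n * a)"
      using False n by (intro powr_mono) auto
    also have "r powr (real n * a) = (y / s) ^ n"
      using False assms by (simp add: y_def powr_powr mult.commute flip: powr_realpow)
    also have "(y / s) ^ n = y ^ n / fact n * (fact n / s ^ n)"
      by (simp add: power_divide)
    also have "y ^ n / fact n \<le> exp y"
      using sum_le_suminf[of "\<lambda>n. y ^ n / fact n" "{n}"] exp_converges[of y] y
      by (auto simp: sums_iff divide_inverse mult.commute)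
    finally have "(1 + r) ^ K \<le> 2 ^ K * (exp y * (fact n / s ^ n))"
      using assms by (simp add: mult_left_mono divide_right_mono)
    then have "(1 + r) ^ K * exp (- y) \<le> 2 ^ K * (exp y * (fact n / s ^ n)) * exp (- y)"
      by (intro mult_right_mono) auto
    also have "\<dots> = 2 ^ K * (fact n / s ^ n)"
      by (simp add: exp_minus)
    also have "\<dots> \<le> 2 ^ K * (1 + fact n / s ^ n)"
      by (intro mult_left_mono) auto
    finally show ?thesis
      by (simp add: y_def)
  qed
  then show ?thesis
    by blast
qed

text \<open>\<open>b\<close> is the homogeneous dimension of the measure with density
  \<open>w\<close>; the exponent in \<open>w_scale\<close> falls short of it by
  \<open>DIM('a)\<close>, which the Jacobian of a dilation supplies. Negative \<open>t\<close> are
  included, so \<open>w\<close> is even. The weight may blow up at 0, and \<open>b > 0\<close> is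
  what keeps balls of finite measure.\<close>

locale homogeneous_weight =
  fixes w :: "'a::euclidean_space \<Rightarrow> real" and b :: real
  assumes w_measurable [measurable]: "w \<in> borel_measurable borel"
    and w_nonneg: "0 \<le> w x"
    and b_pos: "b > 0"
    and w_scale: "t \<noteq> 0 \<Longrightarrow> w (t *\<^sub>R x) = \<bar>t\<bar> powr (b - real DIM('a)) * w x"
    and w_bounded: "\<exists>B. \<forall>x. norm x = 1 \<longrightarrow> w x \<le> B"
    and w_pos: "AE x in lborel. 0 < w x"
begin

section \<open>Scaling, finiteness on balls and integrability for the weighted measure\<close>

definition M :: "'a measure" where
  "M = density lborel (\<lambda>x. ennreal (w x))"

lemma sets_M [measurable_cong, simp]: "sets M = sets borel"
  by (simp add: M_def)

lemma space_M [simp]: "space M = UNIV"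
  by (simp add: M_def)

lemma AE_M_lborel: "(AE x in M. P x) \<longleftrightarrow> (AE x in lborel. P x)"
proof -
  have "(AE x in M. P x) \<longleftrightarrow> (AE x in lborel. 0 < w x \<longrightarrow> P x)"
    unfolding M_def by (subst AE_density) auto
  also have "\<dots> \<longleftrightarrow> (AE x in lborel. P x)"
    using w_pos by (auto elim: AE_mp)
  finally show ?thesis .
qed

lemma nn_integral_scale:
  fixes f :: "'a \<Rightarrow> ennreal"
  assumes [measurable]: "f \<in> borel_measurable borel" and t: "t \<noteq> 0"
  shows "(\<integral>\<^sup>+x. f x \<partial>M) = ennreal (\<bar>t\<bar> powr b) * (\<integral>\<^sup>+x. f (t *\<^sub>R x) \<partial>M)"
proof -
  have eq: "ennreal (\<bar>t\<bar> ^ DIM('a)) * (ennreal (\<bar>t\<bar> powr (b - DIM('a)) * w x) * y) =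
      ennreal (\<bar>t\<bar> powr b) * (ennreal (w x) * y)" for x :: 'a and y
    using t by (simp add: powr_diff powr_realpow ennreal_mult[symmetric] w_nonneg flip: mult.assoc)
  have "(\<integral>\<^sup>+x. f x \<partial>M) = (\<integral>\<^sup>+x. ennreal (w x) * f x \<partial>lborel)"
    unfolding M_def by (subst nn_integral_density) auto
  also have "\<dots> = (\<integral>\<^sup>+x. ennreal (w x) * f x
      \<partial>density (distr lborel borel (\<lambda>x. 0 + t *\<^sub>R x)) (\<lambda>_. \<bar>t\<bar> ^ DIM('a)))"
    by (rule arg_cong[OF lborel_affine[OF t]])
  also have "\<dots> = (\<integral>\<^sup>+x. ennreal (\<bar>t\<bar> ^ DIM('a)) * (ennreal (w (t *\<^sub>R x)) * f (t *\<^sub>R x)) \<partial>lborel)"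
    by (subst nn_integral_density) (auto simp: nn_integral_distr)
  also have "\<dots> = (\<integral>\<^sup>+x. ennreal (\<bar>t\<bar> powr b) * (ennreal (w x) * f (t *\<^sub>R x)) \<partial>lborel)"
    unfolding w_scale[OF t] eq ..
  also have "\<dots> = ennreal (\<bar>t\<bar> powr b) * (\<integral>\<^sup>+x. ennreal (w x) * f (t *\<^sub>R x) \<partial>lborel)"
    by (rule nn_integral_cmult) measurable
  also have "(\<integral>\<^sup>+x. ennreal (w x) * f (t *\<^sub>R x) \<partial>lborel) = (\<integral>\<^sup>+x. f (t *\<^sub>R x) \<partial>M)"
    unfolding M_def by (subst nn_integral_density) auto
  finally show ?thesis .
qed

text \<open>This covers nonintegrable \<open>f\<close>, both sides then being 0. With
  \<open>t = -1\<close> it expresses the evenness of the measure.\<close>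

lemma integral_scale:
  fixes f :: "'a \<Rightarrow> real"
  assumes [measurable]: "f \<in> borel_measurable borel" and t: "t \<noteq> 0"
  shows "(LINT x|M. f x) = \<bar>t\<bar> powr b * (LINT x|M. f (t *\<^sub>R x))"
proof -
  have "(LINT x|M. f x) = (LINT x|lborel. w x * f x)"
    unfolding M_def by (subst integral_density) (auto simp: w_nonneg)
  also have "\<dots> = (LINT x|density (distr lborel borel (\<lambda>x. 0 + t *\<^sub>R x)) (\<lambda>_. ennreal (\<bar>t\<bar> ^ DIM('a))). w x * f x)"
    by (rule arg_cong[OF lborel_affine[OF t, of 0]])
  also have "\<dots> = (LINT x|lborel. \<bar>t\<bar> ^ DIM('a) * (w (t *\<^sub>R x) * f (t *\<^sub>R x)))"
    by (subst integral_density) (auto simp: integral_distr)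
  also have "\<dots> = (LINT x|lborel. \<bar>t\<bar> powr b * (w x * f (t *\<^sub>R x)))"
    unfolding w_scale[OF t] using t
    by (intro Bochner_Integration.integral_cong) (auto simp: powr_diff powr_realpow)
  also have "\<dots> = \<bar>t\<bar> powr b * (LINT x|M. f (t *\<^sub>R x))"
    unfolding M_def by (subst integral_density) (auto simp: w_nonneg)
  finally show ?thesis .
qed

lemma emeasure_cball_scale:
  assumes "r > 0"
  shows "emeasure M (cball 0 r) = ennreal (r powr b) * emeasure M (cball 0 1)"
proof -
  have "emeasure M (cball 0 r) = (\<integral>\<^sup>+x. indicator (cball 0 r) x \<partial>M)"
    by simp
  also have "\<dots> = ennreal (r powr b) * (\<integral>\<^sup>+x. indicator (cball 0 r) (r *\<^sub>R x) \<partial>M)"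
    using assms by (subst nn_integral_scale[of _ r]) (auto intro!: borel_measurable_indicator)
  also have "(\<integral>\<^sup>+x. indicator (cball 0 r) (r *\<^sub>R x) \<partial>M) = (\<integral>\<^sup>+x. indicator (cball 0 1) (x :: 'a) \<partial>M)"
    using assms by (intro nn_integral_cong) (auto simp: indicator_def)
  finally show ?thesis
    by simp
qed

text \<open>As \<open>w\<close> may be unbounded near 0, the ball is cut into dyadic shells. The
  outermost one has finite measure by the bound on the sphere; the others are dilates of it, so the
  measures form a geometric series of ratio \<open>(1/2) powr b\<close>, which is below 1.\<close>

lemma emeasure_cball_finite: "emeasure M (cball 0 1) < \<infinity>"
proof -
  define A where "A n = {x::'a. (1/2) ^ Suc n < norm x \<and> norm x \<le> (1/2) ^ n}" for n :: nat
  have A_meas [measurable]: "A n \<in> sets borel" for n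
    unfolding A_def by measurable
  obtain B where B: "\<And>x. norm x = 1 \<Longrightarrow> w x \<le> B"
    using w_bounded by blast
  \<comment> \<open>On \<open>A 0\<close> the norm lies between 1/2 and 1, so its power with
    exponent \<open>e\<close> is at most \<open>2 powr \<bar>e\<bar>\<close>, whatever the sign of
    \<open>e\<close>.\<close>
  define c where "c = 2 powr \<bar>b - DIM('a)\<bar> * max B 0"
  have w_le: "w x \<le> c" if "x \<in> A 0" for x
  proof -
    have x: "1/2 < norm x" "norm x \<le> 1"
      using that by (auto simp: A_def)
    then have "x \<noteq> 0"
      by auto
    then have "w x = norm x powr (b - DIM('a)) * w (x /\<^sub>R norm x)"
      using w_scale[of "norm x" "x /\<^sub>R norm x"] by simp
    also have "\<dots> \<le> 2 powr \<bar>b - DIM('a)\<bar> * max B 0"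
    proof (intro mult_mono)
      have "norm x powr (b - DIM('a)) \<le> norm x powr (- \<bar>b - DIM('a)\<bar>)"
        using x by (intro powr_mono') auto
      also have "\<dots> \<le> (1/2) powr (- \<bar>b - DIM('a)\<bar>)"
        using x by (intro powr_mono2') auto
      also have "\<dots> = 2 powr \<bar>b - DIM('a)\<bar>"
        by (simp add: powr_minus powr_divide)
      finally show "norm x powr (b - DIM('a)) \<le> 2 powr \<bar>b - DIM('a)\<bar>" .
      have "norm (x /\<^sub>R norm x) = 1"
        using x by (auto simp: field_simps)
      then show "w (x /\<^sub>R norm x) \<le> max B 0"
        using B[of "x /\<^sub>R norm x"] by auto
    qed (auto simp: w_nonneg)
    finally show ?thesis
      by (simp add: c_def)
  qed
  have "emeasure M (A 0) = (\<integral>\<^sup>+x. ennreal (w x) * indicator (A 0) x \<partial>lborel)"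
    unfolding M_def by (rule emeasure_density) auto
  also have "\<dots> \<le> (\<integral>\<^sup>+x. ennreal c * indicator (cball 0 1) (x :: 'a) \<partial>lborel)"
    by (intro nn_integral_mono) (use w_le in \<open>auto simp: indicator_def A_def intro!: ennreal_leI\<close>)
  also have "\<dots> = ennreal c * emeasure lborel (cball 0 1 :: 'a set)"
    by (subst nn_integral_cmult_indicator) auto
  also have "\<dots> < \<infinity>"
    unfolding infinity_ennreal_def ennreal_mult_less_top
    using emeasure_lborel_cball_finite[of "0::'a" 1] ennreal_less_top[of c]
    unfolding infinity_ennreal_def by blast
  finally have A0: "emeasure M (A 0) < \<infinity>" .
  have An: "emeasure M (A n) = ennreal (((1/2) powr b) ^ n) * emeasure M (A 0)" for n
  proof -
    define r :: real where "r = (1/2) ^ n"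
    have "r > 0"
      by (simp add: r_def)
    have "emeasure M (A n) = (\<integral>\<^sup>+x. indicator (A n) x \<partial>M)"
      by simp
    also have "\<dots> = ennreal (r powr b) * (\<integral>\<^sup>+x. indicator (A n) (r *\<^sub>R x) \<partial>M)"
      using \<open>r > 0\<close> by (subst nn_integral_scale[of _ r]) auto
    also have "(\<integral>\<^sup>+x. indicator (A n) (r *\<^sub>R x) \<partial>M) = (\<integral>\<^sup>+x. indicator (A 0) (x :: 'a) \<partial>M)"
      using \<open>r > 0\<close>
      by (intro nn_integral_cong) (auto simp: indicator_def A_def r_def field_simps)
    also have "r powr b = ((1/2) powr b) ^ n"
      by (simp add: r_def powr_powr powr_realpow[symmetric] mult.commute)
    finally show ?thesis
      by simp
  qed
  have "cball 0 1 - {0} \<subseteq> (\<Union>n. A n)"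
  proof
    fix x :: 'a assume x: "x \<in> cball 0 1 - {0}"
    \<comment> \<open>The shells are open at the inner radius, so \<open>x\<close> lies in the one
      just before the first power of 1/2 strictly below \<open>norm x\<close>;
      \<open>norm x \<le> 1\<close> rules out \<open>k = 0\<close>.\<close>
    define k where "k = (LEAST k. (1/2) ^ k < norm x)"
    obtain m where "(1/2) ^ m < norm x"
      using x real_arch_pow_inv[of "norm x" "1/2"] by auto
    then have k: "(1/2) ^ k < norm x"
      unfolding k_def by (rule LeastI)
    with x have "k \<noteq> 0"
      by (cases k) auto
    then obtain n where n: "k = Suc n"
      by (cases k) auto
    have "\<not> (1/2) ^ n < norm x"
      using n not_less_Least[of n "\<lambda>k. (1/2) ^ k < norm x"] by (simp add: k_def)
    then have "x \<in> A n"
      using k n by (simp add: A_def)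
    then show "x \<in> (\<Union>n. A n)"
      by blast
  qed
  moreover have "emeasure M {0} = 0"
    unfolding M_def by (subst emeasure_density) (auto simp: nn_integral_indicator_singleton)
  ultimately have "emeasure M (cball 0 1) \<le> emeasure M (\<Union>n. A n)"
  proof -
    have "emeasure M (cball 0 1) \<le> emeasure M ((\<Union>n. A n) \<union> {0})"
      using \<open>cball 0 1 - {0} \<subseteq> (\<Union>n. A n)\<close> by (intro emeasure_mono) auto
    also have "\<dots> \<le> emeasure M (\<Union>n. A n) + emeasure M {0}"
      by (intro emeasure_subadditive) auto
    finally show ?thesis
      using \<open>emeasure M {0} = 0\<close> by simp
  qed
  also have "\<dots> \<le> (\<Sum>n. emeasure M (A n))"
    by (rule emeasure_subadditive_countably) auto
  also have "\<dots> = (\<Sum>n. ennreal (((1/2) powr b) ^ n) * emeasure M (A 0))"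
    by (intro suminf_cong An)
  also have "\<dots> = (\<Sum>n. ennreal (((1/2) powr b) ^ n)) * emeasure M (A 0)"
    by (rule ennreal_suminf_multc)
  also have "(\<Sum>n. ennreal (((1/2) powr b) ^ n)) = ennreal (\<Sum>n. ((1/2) powr b) ^ n)"
  proof (rule suminf_ennreal2)
    have "(1/2) powr b < (1/2::real) powr 0"
      using b_pos by (intro powr_less_mono') auto
    then show "summable (\<lambda>n. ((1/2) powr b) ^ n)"
      by (intro summable_geometric) auto
  qed auto
  also have "\<dots> * emeasure M (A 0) < \<infinity>"
    using A0 by (simp add: ennreal_mult_less_top)
  finally show ?thesis .
qed

text \<open>Where \<open>n \<le> norm x < n + 1\<close>, \<open>\<bar>f\<bar>\<close> is at most
  \<open>C / (1 + n) ^ K\<close>, and this set lies in a ball of measure proportional to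
  \<open>(1 + n) powr b\<close>. The surplus 2 in \<open>K \<ge> b + 2\<close> leaves the convergent
  series of \<open>1 / (1 + n) ^ 2\<close>.\<close>

lemma integrable_decay:
  fixes f :: "'a \<Rightarrow> real"
  assumes [measurable]: "f \<in> borel_measurable borel" and K: "real K \<ge> b + 2"
    and bound: "\<And>x. (1 + norm x) ^ K * \<bar>f x\<bar> \<le> C"
  shows "integrable M f"
proof (rule integrableI_bounded)
  have "C \<ge> 0"
    using bound[of 0] by simp
  define h where "h n x = ennreal (C / (1 + real n) ^ K) * indicator (cball 0 (1 + real n)) x" for n and x :: 'a
  have [measurable]: "h n \<in> borel_measurable borel" for n
    unfolding h_def by (intro borel_measurable_times_ennreal borel_measurable_indicator) auto
  have "ennreal (norm (f x)) \<le> (\<Sum>n. h n x)" for x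
  proof -
    define n where "n = nat \<lfloor>norm x\<rfloor>"
    have n: "real n \<le> norm x" "norm x \<le> 1 + real n"
      by (auto simp: n_def) linarith+
    have "\<bar>f x\<bar> * (1 + real n) ^ K \<le> \<bar>f x\<bar> * (1 + norm x) ^ K"
      using n by (intro mult_left_mono power_mono) auto
    also have "\<dots> \<le> C"
      using bound[of x] by (simp add: mult.commute)
    finally have "\<bar>f x\<bar> \<le> C / (1 + real n) ^ K"
      by (simp add: field_simps)
    then have "ennreal (norm (f x)) \<le> h n x"
      using n by (auto simp: h_def intro!: ennreal_leI)
    also have "h n x = (\<Sum>i\<in>{n}. h i x)"
      by simp
    also have "\<dots> \<le> (\<Sum>n. h n x)"
      by (intro sum_le_suminf) auto
    finally show ?thesis .
  qed
  then have "(\<integral>\<^sup>+x. ennreal (norm (f x)) \<partial>M) \<le> (\<integral>\<^sup>+x. (\<Sum>n. h n x) \<partial>M)"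
    by (intro nn_integral_mono) auto
  also have "\<dots> = (\<Sum>n. \<integral>\<^sup>+x. h n x \<partial>M)"
    by (intro nn_integral_suminf) measurable
  also have "\<dots> \<le> (\<Sum>n. ennreal (C * (1 / (1 + real n) ^ 2)) * emeasure M (cball 0 1))"
  proof (intro suminf_le summableI)
    fix n
    have "(\<integral>\<^sup>+x. h n x \<partial>M) = ennreal (C / (1 + real n) ^ K) * emeasure M (cball 0 (1 + real n))"
      unfolding h_def by (subst nn_integral_cmult_indicator) auto
    also have "\<dots> = ennreal (C / (1 + real n) ^ K * (1 + real n) powr b) * emeasure M (cball 0 1)"
    proof -
      have "ennreal (C / (1 + real n) ^ K * (1 + real n) powr b) =
          ennreal (C / (1 + real n) ^ K) * ennreal ((1 + real n) powr b)"
        using \<open>C \<ge> 0\<close> by (intro ennreal_mult) auto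
      moreover have "emeasure M (cball 0 (1 + real n)) =
          ennreal ((1 + real n) powr b) * emeasure M (cball 0 1)"
        by (rule emeasure_cball_scale) simp
      ultimately show ?thesis
        by (simp only: mult.assoc)
    qed
    also have "\<dots> \<le> ennreal (C * (1 / (1 + real n) ^ 2)) * emeasure M (cball 0 1)"
    proof (intro mult_right_mono ennreal_leI)
      have "(1 + real n) powr b * (1 + real n) ^ 2 = (1 + real n) powr (b + 2)"
        by (simp add: powr_add powr_numeral)
      also have "\<dots> \<le> (1 + real n) powr (real K)"
        using K by (intro powr_mono) auto
      also have "\<dots> = (1 + real n) ^ K"
        by (simp add: powr_realpow)
      finally have "(1 + real n) powr b / (1 + real n) ^ K \<le> 1 / (1 + real n) ^ 2"
        by (simp add: divide_simps)
      from mult_left_mono[OF this \<open>C \<ge> 0\<close>]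
      show "C / (1 + real n) ^ K * (1 + real n) powr b \<le> C * (1 / (1 + real n) ^ 2)"
        by simp
    qed auto
    finally show "(\<integral>\<^sup>+x. h n x \<partial>M) \<le> \<dots>" .
  qed
  also have "\<dots> = (\<Sum>n. ennreal (C * (1 / (1 + real n) ^ 2))) * emeasure M (cball 0 1)"
    by (rule ennreal_suminf_multc)
  also have "(\<Sum>n. ennreal (C * (1 / (1 + real n) ^ 2))) = ennreal (\<Sum>n. C * (1 / (1 + real n) ^ 2))"
  proof (rule suminf_ennreal2)
    have "summable (\<lambda>n. inverse ((real n) ^ 2))"
      by (rule inverse_power_summable) auto
    then have "summable (\<lambda>n. inverse ((real (Suc n)) ^ 2))"
      by (subst summable_Suc_iff)
    then show "summable (\<lambda>n. C * (1 / (1 + real n) ^ 2))"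
      by (intro summable_mult) (simp add: field_simps)
  qed (use \<open>C \<ge> 0\<close> in auto)
  also have "\<dots> * emeasure M (cball 0 1) < \<infinity>"
    using emeasure_cball_finite by (simp add: ennreal_mult_less_top)
  finally show "(\<integral>\<^sup>+x. ennreal (norm (f x)) \<partial>M) < \<infinity>" .
qed measurable

lemma integrable_exp_decay:
  fixes f :: "'a \<Rightarrow> real"
  assumes "f \<in> borel_measurable borel" and "a > 0" "s > 0"
    and bound: "\<And>x. \<bar>f x\<bar> \<le> D * (1 + norm x) ^ m * exp (- s * norm x powr a)"
  shows "integrable M f"
proof -
  obtain K :: nat where K: "real K \<ge> b + 2"
    using real_arch_simple by blast
  obtain C where C: "\<And>r. r \<ge> 0 \<Longrightarrow> (1 + r) ^ (K + m) * exp (- s * r powr a) \<le> C"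
    using exp_powr_decay[OF assms(2,3)] by blast
  have "D \<ge> 0"
    using bound[of 0] assms(2) abs_ge_zero[of "f 0"] by (simp del: abs_ge_zero)
  have "(1 + norm x) ^ K * \<bar>f x\<bar> \<le> D * C" for x
  proof -
    have "(1 + norm x) ^ K * \<bar>f x\<bar> \<le> (1 + norm x) ^ K * (D * (1 + norm x) ^ m * exp (- s * norm x powr a))"
      by (intro mult_left_mono bound) auto
    also have "\<dots> = D * ((1 + norm x) ^ (K + m) * exp (- s * norm x powr a))"
      by (simp add: power_add)
    also have "\<dots> \<le> D * C"
      using \<open>D \<ge> 0\<close> by (intro mult_left_mono C) auto
    finally show ?thesis .
  qed
  then show ?thesis
    using integrable_decay assms(1) K by blast
qed

text \<open>The origin is exempt from strict positivity because integrands such as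
  \<open>norm x ^ 2 * exp (- u x)\<close> vanish there. As \<open>w\<close> is positive off a null
  set, a zero integral would force \<open>f\<close> to vanish Lebesgue-almost everywhere.\<close>

lemma integral_pos:
  fixes f :: "'a \<Rightarrow> real"
  assumes "integrable M f" and pos: "\<And>x. x \<noteq> 0 \<Longrightarrow> 0 < f x" and "0 \<le> f 0"
  shows "0 < (LINT x|M. f x)"
proof -
  have nonneg: "0 \<le> f x" for x
    using assms by (cases "x = 0") (auto intro: less_imp_le)
  have "(LINT x|M. f x) \<noteq> 0"
  proof
    assume "(LINT x|M. f x) = 0"
    then have "AE x in M. f x = 0"
      using nonneg by (subst (asm) integral_nonneg_eq_0_iff_AE) (use assms in auto)
    then have "AE x in lborel. f x = 0"
      unfolding AE_M_lborel .
    moreover have "AE x in lborel. (x::'a) \<noteq> 0"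
      by (rule AE_lborel_singleton)
    ultimately have "AE x::'a in lborel. False"
      by eventually_elim (use pos in force)
    then show False
      by (simp add: AE_iff_null null_sets_def)
  qed
  moreover have "0 \<le> (LINT x|M. f x)"
    using nonneg by simp
  ultimately show ?thesis
    by simp
qed

end

lemma AE_lborel_inner_neq_0:
  fixes \<alpha> :: "'a::euclidean_space"
  assumes "\<alpha> \<noteq> 0"
  shows "AE x in lborel. \<alpha> \<bullet> x \<noteq> 0"
proof -
  have "{x. \<alpha> \<bullet> x = 0} \<in> null_sets lebesgue"
    using assms by (simp add: negligible_hyperplane flip: negligible_iff_null_sets)
  then have "AE x in lebesgue. x \<notin> {x. \<alpha> \<bullet> x = 0}"
    by (rule AE_not_in)
  then show ?thesis
    by (simp add: AE_completion_iff)
qed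

text \<open>The degrees add up to
  \<open>a - 2 + (\<Sum>\<alpha>\<in>\<Omega>. \<kappa> \<alpha>)\<close>, which is
  \<open>2 * lambda \<Omega> \<kappa> + a - DIM('a)\<close> by definition of \<open>lambda\<close>.
  The constant is left free: \<open>c = 1\<close> serves to prove \<open>norm_const\<close>
  positive, after which \<open>c = norm_const\<close> gives \<open>mu\<close>.\<close>

lemma homogeneous_weight_weight:
  fixes \<Omega> :: "'a::euclidean_space set"
  assumes \<Omega>: "root_system \<Omega>" and \<kappa>: "multiplicity_function \<Omega> \<kappa>"
    and b: "2 * lambda \<Omega> \<kappa> + a > 0" and c: "c > 0"
  shows "homogeneous_weight (\<lambda>x. c * weight \<Omega> \<kappa> a x) (2 * lambda \<Omega> \<kappa> + a)"
proof
  have fin: "finite \<Omega>" and nz: "\<And>\<alpha>. \<alpha> \<in> \<Omega> \<Longrightarrow> \<alpha> \<noteq> 0"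
    using \<Omega> by (auto simp: root_system_def)
  have \<kappa>_nonneg: "\<And>\<alpha>. \<alpha> \<in> \<Omega> \<Longrightarrow> 0 \<le> \<kappa> \<alpha>"
    using \<kappa> by (auto simp: multiplicity_function_def)
  show "(\<lambda>x. c * weight \<Omega> \<kappa> a x) \<in> borel_measurable borel"
    unfolding weight_def by measurable
  show "0 \<le> c * weight \<Omega> \<kappa> a x" for x
    using c by (auto simp: weight_def intro!: mult_nonneg_nonneg prod_nonneg)
  show "0 < 2 * lambda \<Omega> \<kappa> + a"
    by (rule b)
  show "c * weight \<Omega> \<kappa> a (t *\<^sub>R x) =
      \<bar>t\<bar> powr (2 * lambda \<Omega> \<kappa> + a - real DIM('a)) * (c * weight \<Omega> \<kappa> a x)" if "t \<noteq> 0" for t x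
  proof -
    have "(\<Prod>\<alpha>\<in>\<Omega>. \<bar>\<alpha> \<bullet> (t *\<^sub>R x)\<bar> powr \<kappa> \<alpha>) = (\<Prod>\<alpha>\<in>\<Omega>. \<bar>t\<bar> powr \<kappa> \<alpha> * \<bar>\<alpha> \<bullet> x\<bar> powr \<kappa> \<alpha>)"
      by (simp add: abs_mult powr_mult)
    also have "\<dots> = \<bar>t\<bar> powr (\<Sum>\<alpha>\<in>\<Omega>. \<kappa> \<alpha>) * (\<Prod>\<alpha>\<in>\<Omega>. \<bar>\<alpha> \<bullet> x\<bar> powr \<kappa> \<alpha>)"
      using that fin by (simp add: prod.distrib powr_sum)
    finally have "weight \<Omega> \<kappa> a (t *\<^sub>R x) =
        \<bar>t\<bar> powr (a - 2) * \<bar>t\<bar> powr (\<Sum>\<alpha>\<in>\<Omega>. \<kappa> \<alpha>) * weight \<Omega> \<kappa> a x"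
      by (simp add: weight_def powr_mult)
    also have "\<bar>t\<bar> powr (a - 2) * \<bar>t\<bar> powr (\<Sum>\<alpha>\<in>\<Omega>. \<kappa> \<alpha>) =
        \<bar>t\<bar> powr (2 * lambda \<Omega> \<kappa> + a - real DIM('a))"
    proof -
      have eq: "2 * lambda \<Omega> \<kappa> + a - real DIM('a) = (a - 2) + (\<Sum>\<alpha>\<in>\<Omega>. \<kappa> \<alpha>)"
        by (simp add: lambda_def field_simps)
      show ?thesis
        unfolding eq by (rule powr_add[symmetric])
    qed
    finally show ?thesis
      by simp
  qed
  show "\<exists>B. \<forall>x. norm x = 1 \<longrightarrow> c * weight \<Omega> \<kappa> a x \<le> B"
  proof (intro exI allI impI)
    fix x :: 'a assume x: "norm x = 1"
    have "\<bar>\<alpha> \<bullet> x\<bar> \<le> norm \<alpha>" for \<alpha>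
      using Cauchy_Schwarz_ineq2[of \<alpha> x] x by simp
    then have "(\<Prod>\<alpha>\<in>\<Omega>. \<bar>\<alpha> \<bullet> x\<bar> powr \<kappa> \<alpha>) \<le> (\<Prod>\<alpha>\<in>\<Omega>. norm \<alpha> powr \<kappa> \<alpha>)"
      using \<kappa>_nonneg by (intro prod_mono conjI powr_mono2) auto
    then show "c * weight \<Omega> \<kappa> a x \<le> c * (\<Prod>\<alpha>\<in>\<Omega>. norm \<alpha> powr \<kappa> \<alpha>)"
      using c x by (simp add: weight_def)
  qed
  \<comment> \<open>As \<open>0 powr 0 = 0\<close>, a factor with
    \<open>\<kappa> \<alpha> = 0\<close> still vanishes on its hyperplane, so all hyperplanes are
    discarded.\<close>
  have "AE x in lborel. \<forall>\<alpha>\<in>\<Omega>. \<alpha> \<bullet> x \<noteq> 0"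
    using fin nz by (intro AE_finite_allI AE_lborel_inner_neq_0) auto
  moreover have "AE x in lborel. (x :: 'a) \<noteq> 0"
    by (rule AE_lborel_singleton)
  ultimately show "AE x in lborel. 0 < c * weight \<Omega> \<kappa> a x"
    by eventually_elim (use c in \<open>auto simp: weight_def intro!: mult_pos_pos prod_pos\<close>)
qed

section \<open>Gaussians and Taylor expansions\<close>

lemma real_polynomial_function_derivative:
  fixes p :: "'a::real_normed_vector \<Rightarrow> real"
  assumes "real_polynomial_function p"
  shows "\<exists>p'. (\<forall>x. (p has_derivative p' x) (at x)) \<and> (\<forall>v. real_polynomial_function (\<lambda>x. p' x v))"
  using assms
proof induction
  case (linear f)
  then show ?case
    by (intro exI[of _ "\<lambda>_. f"])
      (auto intro: bounded_linear_imp_has_derivative real_polynomial_function.intros(2))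
next
  case (const c)
  show ?case
    by (intro exI[of _ "\<lambda>_ _. 0"]) (auto intro: real_polynomial_function.intros(2))
next
  case (add f g)
  then obtain f' g' where
    "\<And>x. (f has_derivative f' x) (at x)" "\<And>v. real_polynomial_function (\<lambda>x. f' x v)"
    "\<And>x. (g has_derivative g' x) (at x)" "\<And>v. real_polynomial_function (\<lambda>x. g' x v)"
    by blast
  then show ?case
    by (intro exI[of _ "\<lambda>x v. f' x v + g' x v"])
      (auto intro: has_derivative_add real_polynomial_function.intros(3))
next
  case (mult f g)
  then obtain f' g' where
    "\<And>x. (f has_derivative f' x) (at x)" "\<And>v. real_polynomial_function (\<lambda>x. f' x v)"
    "\<And>x. (g has_derivative g' x) (at x)" "\<And>v. real_polynomial_function (\<lambda>x. g' x v)"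
    by blast
  then show ?case
    using mult.hyps
    by (intro exI[of _ "\<lambda>x v. f x * g' x v + f' x v * g x"])
      (auto intro!: has_derivative_mult real_polynomial_function.intros(3) real_polynomial_function.intros(4))
qed

lemma real_polynomial_function_growth:
  fixes p :: "'a::real_normed_vector \<Rightarrow> real"
  assumes "real_polynomial_function p"
  shows "\<exists>C m. \<forall>x. \<bar>p x\<bar> \<le> C * (1 + norm x) ^ m"
  using assms
proof induction
  case (linear f)
  then obtain K where "\<And>x. norm (f x) \<le> norm x * K" "K > 0"
    using bounded_linear.pos_bounded by blast
  then have "\<bar>f x\<bar> \<le> K * (1 + norm x) ^ 1" for x
    by (smt (verit) mult.commute mult_left_mono norm_ge_zero power_one_right real_norm_def)
  then show ?case
    by blast
next
  case (const c)
  show ?case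
    by (rule exI[of _ "\<bar>c\<bar>"], rule exI[of _ 0]) simp
next
  case (add f g)
  then obtain C m D n where f: "\<And>x. \<bar>f x\<bar> \<le> C * (1 + norm x) ^ m"
    and g: "\<And>x. \<bar>g x\<bar> \<le> D * (1 + norm x) ^ n"
    by blast
  have "0 \<le> C" "0 \<le> D"
    using f[of 0] g[of 0] by auto
  have "\<bar>f x + g x\<bar> \<le> (C + D) * (1 + norm x) ^ (m + n)" for x
  proof -
    have "\<bar>f x + g x\<bar> \<le> C * (1 + norm x) ^ m + D * (1 + norm x) ^ n"
      using f[of x] g[of x] by linarith
    also have "\<dots> \<le> C * (1 + norm x) ^ (m + n) + D * (1 + norm x) ^ (m + n)"
      using \<open>0 \<le> C\<close> \<open>0 \<le> D\<close> by (intro add_mono mult_left_mono power_increasing) auto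
    finally show ?thesis
      by (simp add: distrib_right)
  qed
  then show ?case
    by blast
next
  case (mult f g)
  then obtain C m D n where f: "\<And>x. \<bar>f x\<bar> \<le> C * (1 + norm x) ^ m"
    and g: "\<And>x. \<bar>g x\<bar> \<le> D * (1 + norm x) ^ n"
    by blast
  have "\<bar>f x * g x\<bar> \<le> (C * D) * (1 + norm x) ^ (m + n)" for x
    using mult_mono[OF f[of x] g[of x]] f[of x] by (simp add: abs_mult power_add mult_ac)
  then show ?case
    by blast
qed

definition gaussian :: "'a::real_normed_vector \<Rightarrow> real" where
  "gaussian x = exp (- (norm x)\<^sup>2)"

lemma has_derivative_times_gaussian:
  fixes p :: "'a::real_inner \<Rightarrow> real"
  assumes "(p has_derivative p') (at x)"
  shows "((\<lambda>x. complex_of_real (p x * gaussian x)) has_derivative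
    (\<lambda>v. complex_of_real ((p' v + p x * (- 2 * (x \<bullet> v))) * gaussian x))) (at x)"
  unfolding gaussian_def power2_norm_eq_inner
  by (rule has_derivative_eq_rhs, (rule derivative_intros assms)+)
     (auto simp: fun_eq_iff inner_commute algebra_simps)

text \<open>Polynomials times the Gaussian are stable under differentiation: along \<open>v\<close>,
  \<open>p\<close> passes to its derivative minus \<open>2 * (x \<bullet> v) * p x\<close>.\<close>

lemma iter_deriv_gaussian:
  fixes vs :: "'a::real_inner list"
  shows "\<exists>p. real_polynomial_function p \<and>
    iter_deriv vs (\<lambda>x. complex_of_real (gaussian x)) = (\<lambda>x. complex_of_real (p x * gaussian x))"
proof (induction vs)
  case Nil
  show ?case
    by (intro exI[of _ "\<lambda>_. 1"]) (auto intro: real_polynomial_function.intros(2))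
next
  case (Cons v vs)
  then obtain p where p: "real_polynomial_function p"
    and eq: "iter_deriv vs (\<lambda>x. complex_of_real (gaussian x)) = (\<lambda>x. complex_of_real (p x * gaussian x))"
    by blast
  obtain p' where p': "\<And>x. (p has_derivative p' x) (at x)"
    and p'_poly: "\<And>v. real_polynomial_function (\<lambda>x. p' x v)"
    using real_polynomial_function_derivative[OF p] by blast
  have "iter_deriv (v # vs) (\<lambda>x. complex_of_real (gaussian x)) =
      (\<lambda>x. complex_of_real ((p' x v + p x * (- 2 * (x \<bullet> v))) * gaussian x))"
    unfolding iter_deriv.simps eq
      frechet_derivative_at[OF has_derivative_times_gaussian[OF p'], symmetric] ..
  moreover have "real_polynomial_function (\<lambda>x. p' x v + p x * (- 2 * (x \<bullet> v)))"
    by (intro real_polynomial_function.intros(3) real_polynomial_function.intros(4) p p'_poly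
        real_polynomial_function.intros(2) real_polynomial_function.intros(1) bounded_linear_inner_left)
  ultimately show ?case
    by blast
qed

lemma gaussian_schwartz: "(\<lambda>x::'a::euclidean_space. complex_of_real (gaussian x)) \<in> schwartz"
  unfolding schwartz_def smooth_def
proof (intro CollectI conjI allI impI)
  fix vs :: "'a list" and x :: 'a
  obtain p where p: "real_polynomial_function p"
    and eq: "iter_deriv vs (\<lambda>x. complex_of_real (gaussian x)) = (\<lambda>x. complex_of_real (p x * gaussian x))"
    using iter_deriv_gaussian by blast
  obtain p' where p': "\<And>x. (p has_derivative p' x) (at x)"
    using real_polynomial_function_derivative[OF p] by blast
  show "iter_deriv vs (\<lambda>x. complex_of_real (gaussian x)) differentiable at x"
    unfolding eq using has_derivative_times_gaussian[OF p'] by (rule differentiableI)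
next
  fix N and vs :: "'a list"
  obtain p where p: "real_polynomial_function p"
    and eq: "iter_deriv vs (\<lambda>x. complex_of_real (gaussian x)) = (\<lambda>x. complex_of_real (p x * gaussian x))"
    using iter_deriv_gaussian by blast
  obtain C m where C: "\<And>x. \<bar>p x\<bar> \<le> C * (1 + norm x) ^ m"
    using real_polynomial_function_growth[OF p] by blast
  obtain D where D: "\<And>r. r \<ge> 0 \<Longrightarrow> (1 + r) ^ (N + m) * exp (- 1 * r powr (2::real)) \<le> D"
    using exp_powr_decay[of 2 1 "N + m"] by auto
  have "C \<ge> 0"
    using C[of 0] by auto
  have "norm (norm x ^ N *\<^sub>R complex_of_real (p x * gaussian x)) \<le> C * D" for x
  proof -
    have "norm (norm x ^ N *\<^sub>R complex_of_real (p x * gaussian x)) =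
        norm x ^ N * \<bar>p x\<bar> * exp (- 1 * norm x powr 2)"
      by (simp add: gaussian_def norm_mult power_abs powr_numeral)
    also have "\<dots> \<le> (1 + norm x) ^ N * (C * (1 + norm x) ^ m) * exp (- 1 * norm x powr 2)"
      by (intro mult_right_mono mult_mono C power_mono) auto
    also have "\<dots> = C * ((1 + norm x) ^ (N + m) * exp (- 1 * norm x powr 2))"
      by (simp add: power_add)
    also have "\<dots> \<le> C * D"
      using \<open>C \<ge> 0\<close> by (intro mult_left_mono D) auto
    finally show ?thesis .
  qed
  then show "bounded (range (\<lambda>x. norm x ^ N *\<^sub>R iter_deriv vs (\<lambda>x. complex_of_real (gaussian x)) x))"
    unfolding eq bounded_iff by blast
qed

text \<open>The Lagrange remainder carries \<open>exp (- t) \<le> 1\<close> at the intermediate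
  point, so the bound is a pure power of \<open>v\<close> on the whole half-line and can be
  integrated over all of space.\<close>

lemma exp_minus_taylor_bound:
  fixes v :: real
  assumes "v \<ge> 0"
  shows "\<bar>exp (- v) - (\<Sum>j\<le>n. (- v) ^ j / fact j)\<bar> \<le> v ^ Suc n / fact (Suc n)"
proof (cases "v = 0")
  case True
  then show ?thesis
    by (simp add: zero_power sum.atMost_shift)
next
  case False
  with assms have "v > 0"
    by simp
  have "\<exists>t. 0 < t \<and> t < v \<and> exp (- v) =
      (\<Sum>m<Suc n. ((-1) ^ m * exp (- 0)) / fact m * v ^ m) + ((-1) ^ Suc n * exp (- t)) / fact (Suc n) * v ^ Suc n"
    using \<open>v > 0\<close>
    by (intro Maclaurin[where diff = "\<lambda>m t. (-1) ^ m * exp (- t)" and f = "\<lambda>t. exp (- t)"])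
       (auto intro!: derivative_eq_intros)
  then obtain t where t: "0 < t" "exp (- v) =
      (\<Sum>m<Suc n. ((-1) ^ m * exp (- 0)) / fact m * v ^ m) + ((-1) ^ Suc n * exp (- t)) / fact (Suc n) * v ^ Suc n"
    by blast
  moreover have "(\<Sum>m<Suc n. ((-1) ^ m * exp (- 0)) / fact m * v ^ m) = (\<Sum>j\<le>n. (- v) ^ j / fact j)"
    unfolding lessThan_Suc_atMost by (intro sum.cong refl) (simp add: power_minus[of v])
  ultimately have "\<bar>exp (- v) - (\<Sum>j\<le>n. (- v) ^ j / fact j)\<bar> = exp (- t) * (v ^ Suc n / fact (Suc n))"
    using \<open>v > 0\<close> by (simp add: abs_mult)
  also have "\<dots> \<le> 1 * (v ^ Suc n / fact (Suc n))"
    using t \<open>v > 0\<close> by (intro mult_right_mono) auto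
  finally show ?thesis
    by simp
qed

text \<open>Taylor's formula along the ray \<open>t *\<^sub>R y\<close>, with \<open>C\<close> from
  compactness of the unit ball. Continuity and homogeneity of \<open>P k\<close> are exported
  because growth bounds and scaling rest on them.\<close>

lemma smooth_taylor_expansion:
  fixes h :: "'a::euclidean_space \<Rightarrow> complex"
  assumes "smooth h"
  obtains P :: "nat \<Rightarrow> 'a \<Rightarrow> real" and C where
    "\<And>k. continuous_on UNIV (P k)" "\<And>k t y. P k (t *\<^sub>R y) = t ^ k * P k y"
    "\<And>y. norm y \<le> 1 \<Longrightarrow> \<bar>Re (h y) - (\<Sum>k\<le>N. P k y)\<bar> \<le> C * norm y ^ Suc N"
proof -
  \<comment> \<open>Words of directions match the list argument of \<open>iter_deriv\<close>. A
    multi-index is counted once for each of its orderings, which supplies the multinomial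
    coefficients.\<close>
  define L where "L k = {vs :: 'a list. set vs \<subseteq> Basis \<and> length vs = k}" for k
  have fin: "finite (L k)" for k
    unfolding L_def by (rule finite_lists_length_eq) simp
  define m where "m y vs = prod_list (map (\<lambda>v. y \<bullet> v) vs)" for y :: 'a and vs
  define D where "D k y x = (\<Sum>vs\<in>L k. m y vs *\<^sub>R iter_deriv vs h x)" for k y x
  have m_scale: "m (t *\<^sub>R y) vs = t ^ length vs * m y vs" for t y vs
    unfolding m_def by (induction vs) auto
  have m_le: "\<bar>m y vs\<bar> \<le> norm y ^ length vs" if "set vs \<subseteq> Basis" for y vs
    using that unfolding m_def
    by (induction vs) (auto simp: abs_mult Basis_le_norm intro!: mult_mono)
  have diff: "iter_deriv vs h differentiable at x" if "vs \<in> L k" for vs k x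
    using that assms by (auto simp: smooth_def L_def)
  have deriv: "((\<lambda>t. D k y (t *\<^sub>R y)) has_vector_derivative D (Suc k) y (t *\<^sub>R y)) (at t)" for k y t
  proof -
    have "((\<lambda>t. iter_deriv vs h (t *\<^sub>R y)) has_vector_derivative
        (\<Sum>v\<in>Basis. (y \<bullet> v) *\<^sub>R iter_deriv (v # vs) h (t *\<^sub>R y))) (at t)" if "vs \<in> L k" for vs
    proof -
      let ?f' = "frechet_derivative (iter_deriv vs h) (at (t *\<^sub>R y))"
      have f': "(iter_deriv vs h has_derivative ?f') (at (t *\<^sub>R y))"
        using diff[OF that] by (simp add: frechet_derivative_works)
      have "((\<lambda>t. t *\<^sub>R y) has_vector_derivative y) (at t)"
        by (auto intro!: derivative_eq_intros)
      from vector_derivative_diff_chain_within[OF this has_derivative_at_withinI[OF f']]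
      have "((\<lambda>t. iter_deriv vs h (t *\<^sub>R y)) has_vector_derivative ?f' y) (at t)"
        by (simp add: o_def)
      moreover have "?f' y = ?f' (\<Sum>v\<in>Basis. (y \<bullet> v) *\<^sub>R v)"
        by (simp add: euclidean_representation)
      moreover have "\<dots> = (\<Sum>v\<in>Basis. (y \<bullet> v) *\<^sub>R ?f' v)"
        using has_derivative_linear[OF f'] by (simp add: linear_sum linear_scale)
      ultimately show ?thesis
        by simp
    qed
    then have "((\<lambda>t. D k y (t *\<^sub>R y)) has_vector_derivative
        (\<Sum>vs\<in>L k. m y vs *\<^sub>R (\<Sum>v\<in>Basis. (y \<bullet> v) *\<^sub>R iter_deriv (v # vs) h (t *\<^sub>R y)))) (at t)"
      unfolding D_def
      by (intro has_vector_derivative_sum)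
         (auto intro: bounded_linear.has_vector_derivative[OF bounded_linear_scaleR_right])
    also have "(\<Sum>vs\<in>L k. m y vs *\<^sub>R (\<Sum>v\<in>Basis. (y \<bullet> v) *\<^sub>R iter_deriv (v # vs) h (t *\<^sub>R y))) =
        (\<Sum>(vs, v)\<in>L k \<times> Basis. m y (v # vs) *\<^sub>R iter_deriv (v # vs) h (t *\<^sub>R y))"
      by (simp add: sum.cartesian_product[symmetric] scaleR_sum_right m_def mult.commute)
    also have "\<dots> = D (Suc k) y (t *\<^sub>R y)"
      unfolding D_def L_def lists_length_Suc_eq
      by (subst sum.reindex) (auto simp: inj_on_def case_prod_beta)
    finally show ?thesis .
  qed
  have "\<exists>B. \<forall>x\<in>cball 0 1. norm (iter_deriv vs h x) \<le> B" if "vs \<in> L (Suc N)" for vs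
  proof -
    have "continuous_on (cball 0 1) (iter_deriv vs h)"
      by (intro continuous_at_imp_continuous_on ballI differentiable_imp_continuous_within diff[OF that])
    then have "bounded (iter_deriv vs h ` cball 0 1)"
      by (intro compact_imp_bounded compact_continuous_image compact_cball)
    then show ?thesis
      by (auto simp: bounded_iff)
  qed
  then obtain B where B: "\<And>vs x. vs \<in> L (Suc N) \<Longrightarrow> norm x \<le> 1 \<Longrightarrow> norm (iter_deriv vs h x) \<le> B vs"
    by (metis mem_cball_0)
  define P where "P k y = Re (D k y 0) / fact k" for k y
  show thesis
  proof
    show "continuous_on UNIV (P k)" for k
    proof -
      have "continuous_on UNIV (\<lambda>y. m y vs)" for vs
        unfolding m_def by (induction vs) (auto intro!: continuous_intros)
      then show ?thesis
        unfolding P_def D_def by (intro continuous_intros) auto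
    qed
    show "P k (t *\<^sub>R y) = t ^ k * P k y" for k t y
    proof -
      have "D k (t *\<^sub>R y) 0 = t ^ k *\<^sub>R D k y 0"
        unfolding D_def scaleR_sum_right by (intro sum.cong refl) (auto simp: m_scale L_def)
      then show ?thesis
        by (simp add: P_def)
    qed
    fix y :: 'a assume y: "norm y \<le> 1"
    \<comment> \<open>A remainder at one intermediate point is available for real functions, hence
      the real part.\<close>
    have "\<exists>t. 0 < t \<and> t < 1 \<and> Re (D 0 y (1 *\<^sub>R y)) =
        (\<Sum>k<Suc N. Re (D k y (0 *\<^sub>R y)) / fact k * 1 ^ k) + Re (D (Suc N) y (t *\<^sub>R y)) / fact (Suc N) * 1 ^ Suc N"
      by (rule Maclaurin[where diff = "\<lambda>k t. Re (D k y (t *\<^sub>R y))"])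
         (auto simp: has_real_derivative_iff_has_vector_derivative
               intro!: bounded_linear.has_vector_derivative[OF bounded_linear_Re] deriv)
    moreover have "L 0 = {[]}"
      by (auto simp: L_def)
    then have "D 0 y y = h y"
      by (simp add: D_def m_def)
    ultimately obtain t where t: "0 < t" "t < 1"
      and "Re (h y) - (\<Sum>k\<le>N. P k y) = Re (D (Suc N) y (t *\<^sub>R y)) / fact (Suc N)"
      by (auto simp: P_def lessThan_Suc_atMost)
    then have "\<bar>Re (h y) - (\<Sum>k\<le>N. P k y)\<bar> \<le> \<bar>Re (D (Suc N) y (t *\<^sub>R y))\<bar> / 1"
      by (auto intro!: divide_left_mono fact_ge_1 simp del: fact_Suc div_by_1)
    also have "\<dots> \<le> norm (D (Suc N) y (t *\<^sub>R y))"
      using abs_Re_le_cmod by simp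
    also have "\<dots> \<le> (\<Sum>vs\<in>L (Suc N). norm y ^ Suc N * B vs)"
      unfolding D_def
    proof (intro sum_norm_le)
      fix vs assume vs: "vs \<in> L (Suc N)"
      have "norm (t *\<^sub>R y) \<le> 1 * 1"
        using t y unfolding norm_scaleR by (intro mult_mono) auto
      then show "norm (m y vs *\<^sub>R iter_deriv vs h (t *\<^sub>R y)) \<le> norm y ^ Suc N * B vs"
        using vs m_le[of vs y] B[OF vs, of "t *\<^sub>R y"] unfolding norm_scaleR L_def
        by (intro mult_mono) auto
    qed
    also have "\<dots> = (\<Sum>vs\<in>L (Suc N). B vs) * norm y ^ Suc N"
      by (simp add: sum_distrib_right mult.commute)
    finally show "\<bar>Re (h y) - (\<Sum>k\<le>N. P k y)\<bar> \<le> (\<Sum>vs\<in>L (Suc N). B vs) * norm y ^ Suc N" .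
  qed
qed

section \<open>Comparison of asymptotic expansions\<close>

text \<open>If \<open>Q\<close> vanishes to order \<open>m\<close> at 0, then \<open>Q t / t powr c\<close> behaves like \<open>t powr (m - c)\<close>, which has
  a finite nonzero limit only for \<open>m = c\<close>.\<close>

lemma exponent_Nats_if_poly_over_powr_tendsto:
  fixes Q :: "real poly" and c D :: real
  assumes lim: "((\<lambda>t. poly Q t / t powr c) \<longlongrightarrow> D) (at_right 0)" and "D \<noteq> 0"
  shows "c \<in> \<nat>"
proof -
  have "Q \<noteq> 0"
    using lim \<open>D \<noteq> 0\<close> by (auto simp: tendsto_const_iff)
  define m where "m = order 0 Q"
  obtain R where R: "Q = [:0, 1:] ^ m * R" and "\<not> [:0, 1:] dvd R"
    using order_decomp[OF \<open>Q \<noteq> 0\<close>, of 0] by (auto simp: m_def)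
  then have "poly R 0 \<noteq> 0"
    by (simp add: dvd_iff_poly_eq_0)
  have R_lim: "(poly R \<longlongrightarrow> poly R 0) (at_right 0)"
    using poly_isCont[of 0 R] unfolding isCont_def by (rule filterlim_mono) (auto simp: at_within_le_at)
  have ev: "\<forall>\<^sub>F t in at_right 0. t > (0::real)"
    by (simp add: eventually_at_right_less)
  have powr_lim: "((\<lambda>t. t powr e) \<longlongrightarrow> 0) (at_right (0::real))" if "e > 0" for e :: real
    using that by real_asymp
  consider "c = m" | "c < m" | "c > m"
    by linarith
  then show ?thesis
  proof cases
    case 2
    have "((\<lambda>t. t powr (m - c) * poly R t) \<longlongrightarrow> 0 * poly R 0) (at_right 0)"
      using 2 by (intro tendsto_mult powr_lim R_lim) auto
    moreover have "\<forall>\<^sub>F t in at_right 0. t powr (m - c) * poly R t = poly Q t / t powr c"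
      using ev by eventually_elim (simp add: R poly_power powr_diff powr_realpow)
    ultimately have "((\<lambda>t. poly Q t / t powr c) \<longlongrightarrow> 0) (at_right 0)"
      by (simp cong: filterlim_cong)
    with lim \<open>D \<noteq> 0\<close> show ?thesis
      using tendsto_unique[OF _ lim] by force
  next
    case 3
    have "((\<lambda>t. t powr (c - m) * (poly Q t / t powr c)) \<longlongrightarrow> 0 * D) (at_right 0)"
      using 3 by (intro tendsto_mult powr_lim lim) auto
    moreover have "\<forall>\<^sub>F t in at_right 0. t powr (c - m) * (poly Q t / t powr c) = poly R t"
      using ev by eventually_elim (simp add: R poly_power powr_diff powr_realpow)
    ultimately have "(poly R \<longlongrightarrow> 0) (at_right 0)"
      by (simp cong: filterlim_cong)
    with \<open>poly R 0 \<noteq> 0\<close> show ?thesis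
      using tendsto_unique[OF _ R_lim] by force
  qed auto
qed

lemma powr_power_growth:
  fixes a :: real
  assumes a: "a > 0"
  shows "\<exists>n. \<forall>r\<ge>0. (r powr a / a) ^ j \<le> 1 / a ^ j * (1 + r) ^ n"
proof -
  obtain n :: nat where n: "a * real j \<le> real n"
    using real_arch_simple by blast
  have "(r powr a / a) ^ j \<le> 1 / a ^ j * (1 + r) ^ n" if r: "r \<ge> 0" for r
  proof -
    have "(r powr a) ^ j \<le> ((1 + r) powr a) ^ j"
      using a r by (intro power_mono powr_mono2) auto
    also have "\<dots> = (1 + r) powr (a * real j)"
      using r by (simp add: powr_power mult.commute)
    also have "\<dots> \<le> (1 + r) powr n"
      using n r by (intro powr_mono) auto
    also have "\<dots> = (1 + r) ^ n"
      using r by (simp add: powr_realpow)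
    finally show ?thesis
      using a by (simp add: power_divide divide_right_mono)
  qed
  then show ?thesis
    by blast
qed

section \<open>From the inversion formula to the two exponents\<close>

context homogeneous_weight
begin

lemma abs_integral_diff_le:
  fixes f g :: "'a \<Rightarrow> real"
  assumes "integrable M f" "integrable M g" "integrable M h"
    and "AE x in M. \<bar>f x - g x\<bar> \<le> h x"
  shows "\<bar>(LINT x|M. f x) - (LINT x|M. g x)\<bar> \<le> (LINT x|M. h x)"
proof -
  have "\<bar>(LINT x|M. f x) - (LINT x|M. g x)\<bar> = \<bar>LINT x|M. f x - g x\<bar>"
    using assms by simp
  also have "\<dots> \<le> (LINT x|M. h x)"
    using assms integral_norm_bound[of M "\<lambda>x. f x - g x"]
      integral_mono_AE[of M "\<lambda>x. \<bar>f x - g x\<bar>" h] by (auto intro: order_trans)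
  finally show ?thesis .
qed

text \<open>The even part of the Taylor expansion of \<open>h\<close> at 0 gives an expansion in powers of
  \<open>\<tau> = s powr (- 2 / a)\<close> of the left-hand side of the inversion formula as \<open>s\<close> tends to infinity,
  while the right-hand side has the term \<open>- m\<^sub>1 \<tau> powr (a / 2)\<close> with \<open>m\<^sub>1 > 0\<close>.\<close>

lemma half_exponent_Nats_if_smooth:
  fixes g :: "'a \<Rightarrow> real" and h :: "'a \<Rightarrow> complex"
  assumes a: "a > 0" and h: "smooth h" and gh: "AE x in M. g x = Re (h x)"
    and g_meas [measurable]: "g \<in> borel_measurable borel"
    and g_int: "\<And>s. s > 0 \<Longrightarrow> integrable M (\<lambda>x. g x * exp (- s * (norm x powr a / a)))"
    and inversion: "\<And>s. s > 0 \<Longrightarrow> (LINT x|M. g x * exp (- s * (norm x powr a / a))) =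
      s powr (- b / a) * (LINT x|M. gaussian x * exp (- (1 / s) * (norm x powr a / a)))"
  shows "a / 2 \<in> \<nat>"
proof -
  define u where "u x = norm x powr a / a" for x :: 'a
  have [measurable]: "u \<in> borel_measurable borel"
    unfolding u_def by measurable
  have u_nonneg: "u x \<ge> 0" for x
    using a by (simp add: u_def)
  obtain J :: nat where J: "a / 2 < real J"
    using reals_Archimedean2 by blast
  \<comment> \<open>As \<open>2 * J > a\<close>, the remainder of order
    \<open>t ^ (2 * J + 2)\<close> is negligible against \<open>t powr a\<close>. With
    \<open>N\<close> odd, the even indices up to \<open>N\<close> are exactly \<open>2 * i\<close>
    for \<open>i \<le> J\<close>.\<close>
  define N where "N = 2 * J + 1"
  obtain P :: "nat \<Rightarrow> 'a \<Rightarrow> real" and C where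
    P_cont: "\<And>k. continuous_on UNIV (P k)"
    and P_scale: "\<And>k t y. P k (t *\<^sub>R y) = t ^ k * P k y"
    and taylor: "\<And>y. norm y \<le> 1 \<Longrightarrow> \<bar>Re (h y) - (\<Sum>k\<le>N. P k y)\<bar> \<le> C * norm y ^ Suc N"
    using smooth_taylor_expansion[OF h, of N] by blast
  have [measurable]: "P k \<in> borel_measurable borel" for k
    using P_cont by (rule borel_measurable_continuous_onI)
  have "\<exists>B. \<forall>x. \<bar>P k x\<bar> \<le> B * (1 + norm x) ^ k" for k
  proof -
    have "bounded (P k ` cball 0 1)"
      by (intro compact_imp_bounded compact_continuous_image continuous_on_subset[OF P_cont]) auto
    then obtain B where B: "\<And>x. norm x \<le> 1 \<Longrightarrow> \<bar>P k x\<bar> \<le> B"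
      unfolding bounded_iff by (metis image_eqI mem_cball_0 real_norm_def)
    have "\<bar>P k x\<bar> \<le> B * (1 + norm x) ^ k" for x
    proof -
      \<comment> \<open>Scaling by \<open>1 + norm x\<close> instead of \<open>norm x\<close> lands
        in the unit ball and avoids a separate case at 0.\<close>
      define r where "r = 1 + norm x"
      have "r > 0"
        by (simp add: r_def add_pos_nonneg)
      then have "\<bar>P k x\<bar> = r ^ k * \<bar>P k (x /\<^sub>R r)\<bar>"
        using P_scale[of k r "x /\<^sub>R r"] by (simp add: abs_mult)
      also have "\<dots> \<le> r ^ k * B"
        using \<open>r > 0\<close> by (intro mult_left_mono B) (auto simp: r_def field_simps)
      finally show ?thesis
        by (simp add: r_def mult.commute)
    qed
    then show ?thesis
      by blast
  qed
  then obtain B where B: "\<And>k x. \<bar>P k x\<bar> \<le> B k * (1 + norm x) ^ k"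
    by metis
  have B_nonneg: "B k \<ge> 0" for k
    using B[of k 0] by auto
  have P_int: "integrable M (\<lambda>x. P k x * exp (- s * u x))" if "s > 0" for k s
  proof (rule integrable_exp_decay[OF _ a, of _ "s / a" "B k" k])
    show "\<bar>P k x * exp (- s * u x)\<bar> \<le> B k * (1 + norm x) ^ k * exp (- (s / a) * norm x powr a)" for x
      using B[of k x] by (simp add: abs_mult u_def mult_right_mono)
  qed (use that a in auto)
  have pow_int: "integrable M (\<lambda>x. (1 + norm x) ^ k * exp (- s * u x))" if "s > 0" for k s
    by (rule integrable_exp_decay[OF _ a, of _ "s / a" 1 k]) (use that a in \<open>auto simp: u_def\<close>)
  have norm_int: "integrable M (\<lambda>x. norm x ^ k * exp (- s * u x))" if "s > 0" for k s
    by (rule Bochner_Integration.integrable_bound[OF pow_int[OF that, of k]])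
       (auto intro!: mult_right_mono power_mono)
  \<comment> \<open>\<open>t\<close> stands for \<open>s powr (- 1 / a)\<close>, so \<open>s\<close>
    tending to infinity means \<open>t\<close> tending to 0. Dilation by \<open>t\<close> turns
    \<open>E t\<close> into \<open>exp (- u)\<close>.\<close>
  define E where "E t x = exp (- (t powr (- a)) * u x)" for t x
  have u_scale: "u (t *\<^sub>R x) = t powr a * u x" if "t > 0" for t x
    using that by (simp add: u_def powr_mult)
  have scale: "(LINT x|M. f x * E t x) = t powr b * (t ^ k * (LINT x|M. f x * exp (- u x)))"
    if t: "t > 0" and f: "f \<in> borel_measurable borel" "\<And>x. f (t *\<^sub>R x) = t ^ k * f x" for t f k
  proof -
    have "(LINT x|M. f x * E t x) = t powr b * (LINT x|M. f (t *\<^sub>R x) * E t (t *\<^sub>R x))"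
      using t f(1) by (subst integral_scale[of _ t]) (auto simp: E_def)
    also have "(LINT x|M. f (t *\<^sub>R x) * E t (t *\<^sub>R x)) = (LINT x|M. t ^ k * (f x * exp (- u x)))"
      using t by (intro Bochner_Integration.integral_cong)
        (auto simp: E_def f(2) u_scale powr_minus field_simps)
    finally show ?thesis
      by simp
  qed
  define A where "A k = (LINT x|M. P k x * exp (- u x))" for k
  \<comment> \<open>The map to \<open>- x\<close> preserves the measure and \<open>u\<close> but
    reverses the sign of \<open>P k\<close>.\<close>
  have A_odd: "A k = 0" if "odd k" for k
  proof -
    have "A k = (LINT x|M. P k (- x) * exp (- u (- x)))"
      unfolding A_def by (subst integral_scale[of _ "-1"]) auto
    also have "\<dots> = - A k"
      using that P_scale[of k "-1"] by (simp add: A_def u_def)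
    finally show ?thesis
      by simp
  qed
  define m where "m j = (LINT x|M. gaussian x * u x ^ j)" for j
  have gauss_int: "integrable M (\<lambda>x. gaussian x * u x ^ j)" for j
  proof -
    obtain n where n: "\<And>r. r \<ge> 0 \<Longrightarrow> (r powr a / a) ^ j \<le> 1 / a ^ j * (1 + r) ^ n"
      using powr_power_growth[OF a] by blast
    show ?thesis
    proof (rule integrable_exp_decay[of _ 2 1 "1 / a ^ j" n])
      fix x :: 'a
      have "u x ^ j \<le> 1 / a ^ j * (1 + norm x) ^ n"
        using n[of "norm x"] by (simp add: u_def)
      then have "u x ^ j * gaussian x \<le> 1 / a ^ j * (1 + norm x) ^ n * gaussian x"
        by (intro mult_right_mono) (auto simp: gaussian_def)
      then show "\<bar>gaussian x * u x ^ j\<bar> \<le> 1 / a ^ j * (1 + norm x) ^ n * exp (- 1 * norm x powr 2)"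
        using u_nonneg[of x] by (simp add: gaussian_def abs_mult mult.commute)
    qed (auto simp: gaussian_def[abs_def])
  qed
  have "m 1 > 0"
    unfolding m_def using a by (intro integral_pos gauss_int) (auto simp: gaussian_def u_def)
  \<comment> \<open>This is the integral on the right of the inversion formula, at
    \<open>1 / s = t powr a\<close>. Two terms are split off; the second, with
    \<open>m 1 > 0\<close>, will force the exponent.\<close>
  define \<Gamma> where "\<Gamma> t = (LINT x|M. gaussian x * exp (- (t powr a) * u x))" for t
  have \<Gamma>_approx: "\<bar>\<Gamma> t - (m 0 - t powr a * m 1)\<bar> \<le> t powr (2 * a) * m 2" if "t > 0" for t
  proof -
    have "\<bar>\<Gamma> t - (LINT x|M. gaussian x * u x ^ 0 - t powr a * (gaussian x * u x ^ 1))\<bar> \<le>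
        (LINT x|M. t powr (2 * a) * (gaussian x * u x ^ 2))"
      unfolding \<Gamma>_def
    proof (intro abs_integral_diff_le Bochner_Integration.integrable_diff integrable_mult_right gauss_int)
      show "integrable M (\<lambda>x. gaussian x * exp (- (t powr a) * u x))"
        by (rule Bochner_Integration.integrable_bound[OF gauss_int[of 0]])
           (auto simp: gaussian_def[abs_def] u_nonneg)
      show "AE x in M. \<bar>gaussian x * exp (- (t powr a) * u x) -
          (gaussian x * u x ^ 0 - t powr a * (gaussian x * u x ^ 1))\<bar> \<le> t powr (2 * a) * (gaussian x * u x ^ 2)"
      proof (intro AE_I2)
        fix x
        define v where "v = t powr a * u x"
        have "v \<ge> 0"
          by (simp add: v_def u_nonneg)
        then have "\<bar>exp (- v) - (1 - v)\<bar> \<le> v ^ 2 / 2"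
          using exp_minus_taylor_bound[of v 1] by (simp add: power2_eq_square)
        then have "\<bar>exp (- v) - (1 - v)\<bar> \<le> v ^ 2"
          using zero_le_power2[of v] by linarith
        then have "gaussian x * \<bar>exp (- v) - (1 - v)\<bar> \<le> gaussian x * v ^ 2"
          by (intro mult_left_mono) (auto simp: gaussian_def)
        moreover have "v ^ 2 = t powr (2 * a) * u x ^ 2"
          using that by (simp add: v_def power_mult_distrib powr_powr mult.commute flip: powr_realpow)
        moreover have "gaussian x * \<bar>exp (- v) - (1 - v)\<bar> =
            \<bar>gaussian x * exp (- (t powr a) * u x) - (gaussian x * u x ^ 0 - t powr a * (gaussian x * u x ^ 1))\<bar>"
          by (simp add: v_def gaussian_def abs_mult_pos' algebra_simps flip: abs_mult)
        ultimately show "\<bar>gaussian x * exp (- (t powr a) * u x) -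
            (gaussian x * u x ^ 0 - t powr a * (gaussian x * u x ^ 1))\<bar> \<le> t powr (2 * a) * (gaussian x * u x ^ 2)"
          by (simp add: mult_ac)
      qed
    qed
    also have "(LINT x|M. t powr (2 * a) * (gaussian x * u x ^ 2)) = t powr (2 * a) * m 2"
      by (simp add: m_def)
    also have "(LINT x|M. gaussian x * u x ^ 0 - t powr a * (gaussian x * u x ^ 1)) = m 0 - t powr a * m 1"
      using gauss_int[of 0] gauss_int[of 1] by (simp add: m_def)
    finally show ?thesis .
  qed
  \<comment> \<open>The Taylor bound is confined to the unit ball; elsewhere \<open>R\<close> is a
    crude bound for \<open>g\<close> minus its Taylor polynomial.\<close>
  define R where "R x = \<bar>g x\<bar> + (\<Sum>k\<le>N. B k * (1 + norm x) ^ k)" for x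
  have R_int: "integrable M (\<lambda>x. R x * exp (- u x))"
    using g_int[of 1] pow_int[of 1] unfolding R_def distrib_right sum_distrib_right mult.assoc
    by (intro Bochner_Integration.integrable_add Bochner_Integration.integrable_sum integrable_mult_right)
       (auto simp: u_def abs_mult dest: integrable_abs)
  define Q where "Q = (LINT x|M. R x * exp (- u x))"
  define K where "K = (LINT x|M. norm x ^ Suc N * exp (- u x))"
  \<comment> \<open>The integral is split at \<open>norm x = 1\<close>. Outside,
    \<open>u \<ge> 1 / a\<close>, and writing \<open>s * u = (s - 1) * u + u\<close> with
    \<open>s = t powr (- a) \<ge> 1\<close> (hence \<open>t \<le> 1\<close>) gains
    \<open>exp (- (s - 1) / a)\<close> while keeping \<open>exp (- u)\<close> to integrate
    \<open>R\<close>. The gain beats the \<open>t powr (- b)\<close> that comes from dividing out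
    the homogeneity.\<close>
  have g_approx: "\<bar>\<Gamma> t - (\<Sum>k\<le>N. A k * t ^ k)\<bar> \<le>
      \<bar>C\<bar> * (t ^ Suc N * K) + t powr (- b) * exp (- ((t powr (- a) - 1) / a)) * Q" if t: "0 < t" "t \<le> 1" for t
  proof -
    have s: "t powr (- a) > 0" "t powr (- a) \<ge> 1"
      using t a by (auto simp: powr_minus field_simps powr_le1)
    have g_int': "integrable M (\<lambda>x. g x * E t x)"
      unfolding E_def u_def using g_int[OF s(1)] by simp
    have pw_int: "integrable M (\<lambda>x. P k x * E t x)" for k
      unfolding E_def using P_int s(1) by blast
    have "\<bar>(LINT x|M. g x * E t x) - (LINT x|M. (\<Sum>k\<le>N. P k x * E t x))\<bar> \<le>
        (LINT x|M. \<bar>C\<bar> * (norm x ^ Suc N * E t x) + exp (- ((t powr (- a) - 1) / a)) * (R x * exp (- u x)))"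
    proof (intro abs_integral_diff_le Bochner_Integration.integrable_add
        Bochner_Integration.integrable_sum integrable_mult_right R_int g_int' pw_int)
      show "integrable M (\<lambda>x. norm x ^ Suc N * E t x)"
        unfolding E_def using norm_int s(1) by blast
      show "AE x in M. \<bar>g x * E t x - (\<Sum>k\<le>N. P k x * E t x)\<bar> \<le>
          \<bar>C\<bar> * (norm x ^ Suc N * E t x) + exp (- ((t powr (- a) - 1) / a)) * (R x * exp (- u x))"
        using gh
      proof eventually_elim
        case (elim x)
        have E_pos: "E t x > 0"
          by (simp add: E_def)
        have R_nonneg: "R x \<ge> 0"
          unfolding R_def using B_nonneg by (intro add_nonneg_nonneg sum_nonneg) auto
        have eq: "\<bar>g x * E t x - (\<Sum>k\<le>N. P k x * E t x)\<bar> = \<bar>g x - (\<Sum>k\<le>N. P k x)\<bar> * E t x"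
          using E_pos unfolding sum_distrib_right[symmetric] left_diff_distrib[symmetric]
          by (simp add: abs_mult)
        show ?case
        proof (cases "norm x \<le> 1")
          case True
          have "\<bar>g x - (\<Sum>k\<le>N. P k x)\<bar> \<le> \<bar>C\<bar> * norm x ^ Suc N"
            using taylor[OF True] elim mult_right_mono[OF abs_ge_self[of C], of "norm x ^ Suc N"] by simp
          then have "\<bar>g x - (\<Sum>k\<le>N. P k x)\<bar> * E t x \<le> \<bar>C\<bar> * (norm x ^ Suc N * E t x)"
            using E_pos by (simp add: mult_right_mono flip: mult.assoc)
          moreover have "0 \<le> exp (- ((t powr (- a) - 1) / a)) * (R x * exp (- u x))"
            using R_nonneg by simp
          ultimately show ?thesis
            unfolding eq by linarith
        next
          case False
          have "\<bar>\<Sum>k\<le>N. P k x\<bar> \<le> (\<Sum>k\<le>N. B k * (1 + norm x) ^ k)"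
            using B by (intro order_trans[OF sum_abs] sum_mono)
          then have 1: "\<bar>g x - (\<Sum>k\<le>N. P k x)\<bar> \<le> R x"
            unfolding R_def by linarith
          have "1 \<le> norm x powr a"
            using False a by (intro ge_one_powr_ge_zero) auto
          then have "1 / a \<le> u x"
            using a by (simp add: u_def divide_right_mono)
          then have "(t powr (- a) - 1) * (1 / a) \<le> (t powr (- a) - 1) * u x"
            using s by (intro mult_left_mono) auto
          then have "- (t powr (- a)) * u x \<le> - ((t powr (- a) - 1) / a) + (- u x)"
            by (simp add: algebra_simps diff_divide_distrib)
          then have 2: "E t x \<le> exp (- ((t powr (- a) - 1) / a)) * exp (- u x)"
            unfolding E_def by (simp flip: exp_add)
          have "\<bar>g x - (\<Sum>k\<le>N. P k x)\<bar> * E t x \<le>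
              R x * (exp (- ((t powr (- a) - 1) / a)) * exp (- u x))"
            using 1 2 R_nonneg E_pos by (intro mult_mono) auto
          moreover have "0 \<le> \<bar>C\<bar> * (norm x ^ Suc N * E t x)"
            using E_pos by (intro mult_nonneg_nonneg) auto
          ultimately show ?thesis
            unfolding eq by (simp add: mult_ac)
        qed
      qed
    qed
    also have "(LINT x|M. \<bar>C\<bar> * (norm x ^ Suc N * E t x) + exp (- ((t powr (- a) - 1) / a)) * (R x * exp (- u x))) =
        \<bar>C\<bar> * (LINT x|M. norm x ^ Suc N * E t x) + exp (- ((t powr (- a) - 1) / a)) * Q"
      using R_int norm_int[OF s(1), of "Suc N"]
      by (subst Bochner_Integration.integral_add) (auto simp: E_def Q_def)
    also have "(LINT x|M. norm x ^ Suc N * E t x) = t powr b * (t ^ Suc N * K)"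
      unfolding K_def using t by (intro scale) (auto simp: power_mult_distrib)
    also have "(LINT x|M. g x * E t x) = t powr b * \<Gamma> t"
    proof -
      have "(t powr (- a)) powr (- b / a) = t powr b"
        using a unfolding powr_powr by simp
      moreover have "1 / t powr (- a) = t powr a"
        unfolding powr_minus_divide by simp
      ultimately show ?thesis
        using inversion[OF s(1)] by (simp only: E_def u_def \<Gamma>_def)
    qed
    also have "(LINT x|M. (\<Sum>k\<le>N. P k x * E t x)) = (\<Sum>k\<le>N. LINT x|M. P k x * E t x)"
      by (rule Bochner_Integration.integral_sum) (rule pw_int)
    also have "\<dots> = t powr b * (\<Sum>k\<le>N. A k * t ^ k)"
      unfolding sum_distrib_left
    proof (intro sum.cong refl)
      fix k
      have "(LINT x|M. P k x * E t x) = t powr b * (t ^ k * A k)"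
        unfolding A_def using t by (intro scale P_scale) auto
      then show "(LINT x|M. P k x * E t x) = t powr b * (A k * t ^ k)"
        by (simp only: mult.commute[of "A k"])
    qed
    finally have "t powr (- b) * \<bar>t powr b * \<Gamma> t - t powr b * (\<Sum>k\<le>N. A k * t ^ k)\<bar> \<le>
        t powr (- b) * (\<bar>C\<bar> * (t powr b * (t ^ Suc N * K)) + exp (- ((t powr (- a) - 1) / a)) * Q)"
      by (intro mult_left_mono) auto
    moreover have "t powr (- b) * \<bar>t powr b * \<Gamma> t - t powr b * (\<Sum>k\<le>N. A k * t ^ k)\<bar> =
        \<bar>\<Gamma> t - (\<Sum>k\<le>N. A k * t ^ k)\<bar>"
      using t by (simp add: abs_mult powr_minus flip: right_diff_distrib)
    moreover have "t powr (- b) * (\<bar>C\<bar> * (t powr b * (t ^ Suc N * K)) + exp (- ((t powr (- a) - 1) / a)) * Q) =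
        \<bar>C\<bar> * (t ^ Suc N * K) + t powr (- b) * exp (- ((t powr (- a) - 1) / a)) * Q"
      using t by (simp add: powr_minus field_simps)
    ultimately show ?thesis
      by simp
  qed
  \<comment> \<open>Only even powers of \<open>t\<close> survive, so the sum is a polynomial in
    \<open>t ^ 2\<close>. Subtracting \<open>m 0\<close> leaves \<open>- m 1 * t powr a\<close> as
    leading behaviour.\<close>
  define q where "q = (\<Sum>i\<le>J. monom (A (2 * i)) i) - [:m 0:]"
  have sum_even: "(\<Sum>k\<le>2 * n + 1. A k * t ^ k) = (\<Sum>i\<le>n. A (2 * i) * (t ^ 2) ^ i)" for t n
    by (induction n) (auto simp: A_odd power_mult power2_eq_square)
  have q: "poly q (t ^ 2) = (\<Sum>k\<le>N. A k * t ^ k) - m 0" for t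
    unfolding q_def N_def sum_even by (simp add: poly_sum poly_monom)
  define err where "err t = \<bar>C\<bar> * (t ^ Suc N * K) +
      t powr (- b) * exp (- ((t powr (- a) - 1) / a)) * Q + t powr (2 * a) * m 2" for t
  have bound: "\<bar>poly q (t ^ 2) / t powr a - (- m 1)\<bar> \<le> err t / t powr a" if "0 < t" "t \<le> 1" for t
  proof -
    have "\<bar>poly q (t ^ 2) + t powr a * m 1\<bar> \<le> err t"
      unfolding q err_def using g_approx[OF that] \<Gamma>_approx[OF that(1)] by linarith
    then have "\<bar>(poly q (t ^ 2) + t powr a * m 1) / t powr a\<bar> \<le> err t / t powr a"
      by (simp add: divide_right_mono)
    then show ?thesis
      using that by (simp add: add_divide_distrib)
  qed
  have err_lim: "((\<lambda>t. err t / t powr a) \<longlongrightarrow> 0) (at_right 0)"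
  proof -
    have 1: "((\<lambda>t::real. t ^ Suc N / t powr a) \<longlongrightarrow> 0) (at_right 0)"
    proof -
      have "a < real (Suc N)"
        using J by (simp add: N_def)
      then have "((\<lambda>t::real. t powr (real (Suc N) - a)) \<longlongrightarrow> 0) (at_right 0)"
        by real_asymp
      moreover have "\<forall>\<^sub>F t in at_right (0::real). t powr (real (Suc N) - a) = t ^ Suc N / t powr a"
        using eventually_at_right_less[of 0]
        by eventually_elim (simp only: powr_diff powr_realpow)
      ultimately show ?thesis
        by (rule Lim_transform_eventually)
    qed
    have 2: "((\<lambda>t::real. t powr (- b) * exp (- ((t powr (- a) - 1) / a)) / t powr a) \<longlongrightarrow> 0) (at_right 0)"
      using a by real_asymp
    have 3: "((\<lambda>t::real. t powr (2 * a) / t powr a) \<longlongrightarrow> 0) (at_right 0)"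
      using a by real_asymp
    have "((\<lambda>t. \<bar>C\<bar> * K * (t ^ Suc N / t powr a) +
        Q * (t powr (- b) * exp (- ((t powr (- a) - 1) / a)) / t powr a) + m 2 * (t powr (2 * a) / t powr a)) \<longlongrightarrow>
        \<bar>C\<bar> * K * 0 + Q * 0 + m 2 * 0) (at_right 0)"
      by (intro tendsto_intros 1 2 3)
    then show ?thesis
      by (simp add: err_def add_divide_distrib mult_ac)
  qed
  have "((\<lambda>t. poly q (t ^ 2) / t powr a - (- m 1)) \<longlongrightarrow> 0) (at_right 0)"
  proof (rule Lim_null_comparison[OF _ err_lim])
    have "\<forall>\<^sub>F t in at_right (0::real). t \<in> {0<..<1}"
      by (rule eventually_at_right_real) simp
    then show "\<forall>\<^sub>F t in at_right 0. norm (poly q (t ^ 2) / t powr a - (- m 1)) \<le> err t / t powr a"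
      by eventually_elim (use bound in auto)
  qed
  then have "((\<lambda>t. poly q (t ^ 2) / t powr a) \<longlongrightarrow> - m 1) (at_right 0)"
    by (rule LIM_zero_cancel)
  moreover have "filterlim sqrt (at_right 0) (at_right 0)"
    by real_asymp
  ultimately have "((\<lambda>\<tau>. poly q (sqrt \<tau> ^ 2) / sqrt \<tau> powr a) \<longlongrightarrow> - m 1) (at_right 0)"
    by (rule filterlim_compose)
  moreover have "\<forall>\<^sub>F \<tau> in at_right (0::real). poly q (sqrt \<tau> ^ 2) / sqrt \<tau> powr a = poly q \<tau> / \<tau> powr (a / 2)"
    using eventually_at_right_less[of 0]
  proof eventually_elim
    case (elim \<tau>)
    then have "sqrt \<tau> powr a = \<tau> powr (a / 2)"
      by (simp add: powr_half_sqrt[symmetric] powr_powr)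
    then show ?case
      using elim by simp
  qed
  ultimately have "((\<lambda>\<tau>. poly q \<tau> / \<tau> powr (a / 2)) \<longlongrightarrow> - m 1) (at_right 0)"
    by (rule Lim_transform_eventually)
  then show ?thesis
    by (rule exponent_Nats_if_poly_over_powr_tendsto) (use \<open>m 1 > 0\<close> in simp)
qed

text \<open>Rapid decrease says nothing on bounded sets, where \<open>h\<close> may be unbounded.
  There square integrability takes over through
  \<open>\<bar>g x\<bar> \<le> (g x)\<^sup>2 + 1\<close>; decay governs the outside of a
  ball.\<close>

lemma integrable_rapidly_decreasing_moment:
  fixes g :: "'a \<Rightarrow> real" and h :: "'a \<Rightarrow> complex"
  assumes h: "rapidly_decreasing h" and gh: "AE x in M. \<bar>g x\<bar> \<le> norm (h x)"
    and [measurable]: "g \<in> borel_measurable borel" and g_sq: "integrable M (\<lambda>x. (g x)\<^sup>2)"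
  shows "integrable M (\<lambda>x. \<bar>g x\<bar> * (1 + norm x) ^ m)"
proof -
  obtain K :: nat where K: "real K \<ge> b + 2"
    using real_arch_simple by blast
  have "((\<lambda>x. norm x ^ (m + K) *\<^sub>R h x) \<longlongrightarrow> 0) at_infinity"
    using h by (simp add: rapidly_decreasing_def)
  then have "\<forall>\<^sub>F x in at_infinity. norm (norm x ^ (m + K) *\<^sub>R h x) < 1"
    by (simp add: tendsto_iff dist_norm)
  then obtain R' where R': "\<And>x. norm x \<ge> R' \<Longrightarrow> norm (norm x ^ (m + K) *\<^sub>R h x) < 1"
    unfolding eventually_at_infinity by blast
  define R where "R = max R' 1"
  have R: "R \<ge> 1"
    by (simp add: R_def)
  \<comment> \<open>\<open>D\<close> serves both regions: inside it dominates
    \<open>(1 + R) ^ m * (1 + norm x) ^ K\<close>; outside it comes from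
    \<open>1 + norm x \<le> (1 + R) * norm x\<close>, for which \<open>R \<ge> 1\<close> was
    arranged.\<close>
  define D where "D = (1 + R) ^ (m + K)"
  define w where "w x = (1 + R) ^ m * (g x)\<^sup>2 + D * (1 / (1 + norm x) ^ K)" for x
  have "integrable M w"
    unfolding w_def
  proof (intro Bochner_Integration.integrable_add integrable_mult_right g_sq)
    have "1 + norm x \<noteq> 0" for x :: 'a
      using norm_ge_zero[of x] by linarith
    then show "integrable M (\<lambda>x. 1 / (1 + norm x) ^ K)"
      by (intro integrable_decay[OF _ K, of _ 1]) auto
  qed
  then show ?thesis
  proof (rule Bochner_Integration.integrable_bound)
    show "AE x in M. norm (\<bar>g x\<bar> * (1 + norm x) ^ m) \<le> norm (w x)"
      using gh
    proof eventually_elim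
      case (elim x)
      have pos: "1 + norm x > 0"
        by (simp add: add_pos_nonneg)
      have "\<bar>g x\<bar> * (1 + norm x) ^ m \<le> w x"
      proof (cases "norm x \<le> R")
        case True
        have "0 \<le> (\<bar>g x\<bar> - 1)\<^sup>2"
          by simp
        then have "\<bar>g x\<bar> \<le> (g x)\<^sup>2 + 1"
          unfolding power2_diff by simp
        then have "\<bar>g x\<bar> * (1 + norm x) ^ m \<le> ((g x)\<^sup>2 + 1) * (1 + R) ^ m"
          using True by (intro mult_mono power_mono) auto
        moreover have "(1 + R) ^ m \<le> D * (1 / (1 + norm x) ^ K)"
        proof -
          have "(1 + R) ^ m * (1 + norm x) ^ K \<le> (1 + R) ^ m * (1 + R) ^ K"
            using True R by (intro mult_left_mono power_mono) auto
          then show ?thesis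
            using pos by (simp add: D_def power_add field_simps)
        qed
        ultimately show ?thesis
          by (simp add: w_def algebra_simps)
      next
        case False
        have "norm x ^ (m + K) * norm (h x) < 1"
          using R'[of x] False by (simp add: R_def)
        then have small: "norm x ^ (m + K) * \<bar>g x\<bar> \<le> 1"
          using elim mult_left_mono[OF elim, of "norm x ^ (m + K)"] by simp
        have growth: "(1 + norm x) ^ (m + K) \<le> ((1 + R) * norm x) ^ (m + K)"
        proof (intro power_mono)
          have "1 * norm x \<le> R * norm x"
            using R by (intro mult_right_mono) auto
          then show "1 + norm x \<le> (1 + R) * norm x"
            using False R by (simp add: distrib_right)
        qed simp
        have "\<bar>g x\<bar> * (1 + norm x) ^ (m + K) \<le> D * 1"
        proof -
          have "\<bar>g x\<bar> * (1 + norm x) ^ (m + K) \<le> \<bar>g x\<bar> * ((1 + R) * norm x) ^ (m + K)"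
            by (intro mult_left_mono growth) simp
          also have "\<dots> = D * (norm x ^ (m + K) * \<bar>g x\<bar>)"
            by (simp add: D_def power_mult_distrib)
          also have "\<dots> \<le> D * 1"
            using R by (intro mult_left_mono small) (simp add: D_def)
          finally show ?thesis .
        qed
        then have "\<bar>g x\<bar> * (1 + norm x) ^ m \<le> D * (1 / (1 + norm x) ^ K)"
          using pos by (simp add: power_add field_simps)
        moreover have "0 \<le> (1 + R) ^ m * (g x)\<^sup>2"
          using R by simp
        ultimately show ?thesis
          unfolding w_def by linarith
      qed
      then show ?case
        by (simp add: abs_mult)
    qed
  qed measurable
qed

text \<open>As \<open>s\<close> tends to 0, the moments of \<open>g\<close> expand the left-hand side of the inversion formula in
  powers of \<open>s\<close>, while after rescaling the right-hand side is the integral of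
  \<open>gaussian (s powr (1 / a) *\<^sub>R x)\<close> against a fixed weight, which contributes \<open>s powr (2 / a)\<close>.\<close>

lemma reciprocal_exponent_Nats_if_rapidly_decreasing:
  fixes g :: "'a \<Rightarrow> real" and h :: "'a \<Rightarrow> complex"
  assumes a: "a > 0" and h: "rapidly_decreasing h" and gh: "AE x in M. \<bar>g x\<bar> \<le> norm (h x)"
    and g_meas [measurable]: "g \<in> borel_measurable borel" and g_sq: "integrable M (\<lambda>x. (g x)\<^sup>2)"
    and inversion: "\<And>s. s > 0 \<Longrightarrow> (LINT x|M. g x * exp (- s * (norm x powr a / a))) =
      s powr (- b / a) * (LINT x|M. gaussian x * exp (- (1 / s) * (norm x powr a / a)))"
  shows "2 / a \<in> \<nat>"
proof -
  define u where "u x = norm x powr a / a" for x :: 'a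
  have [measurable]: "u \<in> borel_measurable borel"
    unfolding u_def by measurable
  have u_nonneg: "u x \<ge> 0" for x
    using a by (simp add: u_def)
  \<comment> \<open>This makes the moment remainder, of order \<open>s ^ Suc J\<close>, negligible
    against \<open>s powr (2 / a)\<close>.\<close>
  obtain J :: nat where J: "2 / a < real J"
    using reals_Archimedean2 by blast
  have mom_int: "integrable M (\<lambda>x. g x * u x ^ j)" for j
  proof -
    obtain n where n: "\<And>r. r \<ge> 0 \<Longrightarrow> (r powr a / a) ^ j \<le> 1 / a ^ j * (1 + r) ^ n"
      using powr_power_growth[OF a] by blast
    have "integrable M (\<lambda>x. 1 / a ^ j * (\<bar>g x\<bar> * (1 + norm x) ^ n))"
      by (intro integrable_mult_right integrable_rapidly_decreasing_moment[OF h gh g_meas g_sq])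
    then show ?thesis
    proof (rule Bochner_Integration.integrable_bound)
      show "AE x in M. norm (g x * u x ^ j) \<le> norm (1 / a ^ j * (\<bar>g x\<bar> * (1 + norm x) ^ n))"
      proof (intro AE_I2)
        fix x
        have "\<bar>g x\<bar> * u x ^ j \<le> \<bar>g x\<bar> * (1 / a ^ j * (1 + norm x) ^ n)"
          using n[of "norm x"] by (intro mult_left_mono) (auto simp: u_def)
        then show "norm (g x * u x ^ j) \<le> norm (1 / a ^ j * (\<bar>g x\<bar> * (1 + norm x) ^ n))"
          using u_nonneg[of x] a by (simp add: abs_mult)
      qed
    qed measurable
  qed
  define B where "B j = (LINT x|M. g x * u x ^ j) * (-1) ^ j / fact j" for j
  define B' where "B' = (LINT x|M. \<bar>g x * u x ^ Suc J\<bar>)"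
  define \<Gamma> where "\<Gamma> s = (LINT x|M. g x * exp (- s * u x))" for s
  have \<Gamma>_int: "integrable M (\<lambda>x. g x * exp (- s * u x))" if "s > 0" for s
    by (rule Bochner_Integration.integrable_bound[OF mom_int[of 0]])
       (use that u_nonneg in \<open>auto simp: abs_mult mult_left_le\<close>)
  have moments: "\<bar>\<Gamma> s - (\<Sum>j\<le>J. B j * s ^ j)\<bar> \<le> s ^ Suc J * B'" if s: "s > 0" for s
  proof -
    have "\<bar>\<Gamma> s - (LINT x|M. (\<Sum>j\<le>J. (-1) ^ j / fact j * s ^ j * (g x * u x ^ j)))\<bar> \<le>
        (LINT x|M. s ^ Suc J * \<bar>g x * u x ^ Suc J\<bar>)"
      unfolding \<Gamma>_def
    proof (intro abs_integral_diff_le Bochner_Integration.integrable_sum integrable_mult_right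
        \<Gamma>_int s integrable_abs mom_int AE_I2)
      fix x
      have "s * u x \<ge> 0"
        using s u_nonneg by simp
      have "(\<Sum>j\<le>J. (-1) ^ j / fact j * s ^ j * (g x * u x ^ j)) = g x * (\<Sum>j\<le>J. (- (s * u x)) ^ j / fact j)"
        unfolding sum_distrib_left
        by (intro sum.cong refl) (simp add: power_minus[of "s * u x"] power_mult_distrib)
      then have "\<bar>g x * exp (- s * u x) - (\<Sum>j\<le>J. (-1) ^ j / fact j * s ^ j * (g x * u x ^ j))\<bar> =
          \<bar>g x\<bar> * \<bar>exp (- (s * u x)) - (\<Sum>j\<le>J. (- (s * u x)) ^ j / fact j)\<bar>"
        by (simp add: abs_mult flip: right_diff_distrib)
      also have "\<dots> \<le> \<bar>g x\<bar> * ((s * u x) ^ Suc J / fact (Suc J))"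
        using \<open>s * u x \<ge> 0\<close> by (intro mult_left_mono exp_minus_taylor_bound) auto
      also have "\<dots> \<le> \<bar>g x\<bar> * ((s * u x) ^ Suc J / 1)"
        using \<open>s * u x \<ge> 0\<close>
        by (intro mult_left_mono divide_left_mono fact_ge_1) (auto simp del: fact_Suc)
      also have "\<dots> = s ^ Suc J * \<bar>g x * u x ^ Suc J\<bar>"
        using u_nonneg[of x] by (simp add: abs_mult power_mult_distrib)
      finally show "\<bar>g x * exp (- s * u x) - (\<Sum>j\<le>J. (-1) ^ j / fact j * s ^ j * (g x * u x ^ j))\<bar> \<le>
          s ^ Suc J * \<bar>g x * u x ^ Suc J\<bar>" .
    qed
    also have "(LINT x|M. (\<Sum>j\<le>J. (-1) ^ j / fact j * s ^ j * (g x * u x ^ j))) = (\<Sum>j\<le>J. B j * s ^ j)"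
    proof -
      have "(LINT x|M. (\<Sum>j\<le>J. (-1) ^ j / fact j * s ^ j * (g x * u x ^ j))) =
          (\<Sum>j\<le>J. LINT x|M. (-1) ^ j / fact j * s ^ j * (g x * u x ^ j))"
        by (intro Bochner_Integration.integral_sum integrable_mult_right mom_int)
      also have "\<dots> = (\<Sum>j\<le>J. B j * s ^ j)"
        unfolding integral_mult_right_zero by (intro sum.cong refl) (simp add: B_def)
      finally show ?thesis .
    qed
    also have "(LINT x|M. s ^ Suc J * \<bar>g x * u x ^ Suc J\<bar>) = s ^ Suc J * B'"
      unfolding B'_def by simp
    finally show ?thesis .
  qed
  define G where "G k = (LINT x|M. norm x ^ k * exp (- u x))" for k
  have G_int: "integrable M (\<lambda>x. norm x ^ k * exp (- u x))" for k
    by (rule integrable_exp_decay[OF _ a, of _ "1 / a" 1 k])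
       (use a in \<open>auto simp: u_def intro!: mult_right_mono power_mono\<close>)
  have "G 2 > 0"
    unfolding G_def by (rule integral_pos[OF G_int]) auto
  have gauss_approx: "\<bar>\<Gamma> s - (G 0 - s powr (2 / a) * G 2)\<bar> \<le> s powr (4 / a) * G 4" if s: "s > 0" for s
  proof -
    \<comment> \<open>Dilation by this \<open>t\<close> multiplies \<open>u\<close> by
      \<open>s\<close> and so moves the parameter from the exponential into the Gaussian; the factor
      \<open>t powr b\<close> cancels the prefactor \<open>s powr (- b / a)\<close>.\<close>
    define t where "t = s powr (1 / a)"
    have t: "t > 0" "t powr a = s" "t powr b = s powr (b / a)" "t ^ 2 = s powr (2 / a)" "t ^ 4 = s powr (4 / a)"
      using s a by (auto simp: t_def powr_powr powr_power)
    have u_scale: "u (t *\<^sub>R x) = s * u x" for x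
      using t by (simp add: u_def powr_mult)
    have "\<Gamma> s = s powr (- b / a) * (LINT x|M. gaussian x * exp (- (1 / s) * u x))"
      unfolding \<Gamma>_def u_def by (rule inversion[OF s])
    also have "(LINT x|M. gaussian x * exp (- (1 / s) * u x)) =
        t powr b * (LINT x|M. gaussian (t *\<^sub>R x) * exp (- (1 / s) * u (t *\<^sub>R x)))"
      using t(1) by (subst integral_scale[of _ t]) (auto simp: gaussian_def[abs_def])
    also have "(LINT x|M. gaussian (t *\<^sub>R x) * exp (- (1 / s) * u (t *\<^sub>R x))) =
        (LINT x|M. exp (- ((t * norm x) ^ 2)) * exp (- u x))"
      using s t(1) unfolding u_scale by (simp add: gaussian_def)
    also have "s powr (- b / a) * (t powr b * (LINT x|M. exp (- ((t * norm x) ^ 2)) * exp (- u x))) =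
        (LINT x|M. exp (- ((t * norm x) ^ 2)) * exp (- u x))"
      using s unfolding t(3) by (simp add: powr_minus)
    finally have "\<Gamma> s = (LINT x|M. exp (- ((t * norm x) ^ 2)) * exp (- u x))" .
    moreover have "\<bar>(LINT x|M. exp (- ((t * norm x) ^ 2)) * exp (- u x)) -
        (LINT x|M. norm x ^ 0 * exp (- u x) - t ^ 2 * (norm x ^ 2 * exp (- u x)))\<bar> \<le>
        (LINT x|M. t ^ 4 * (norm x ^ 4 * exp (- u x)))"
    proof (intro abs_integral_diff_le Bochner_Integration.integrable_diff integrable_mult_right G_int AE_I2)
      show "integrable M (\<lambda>x. exp (- ((t * norm x) ^ 2)) * exp (- u x))"
        by (rule Bochner_Integration.integrable_bound[OF G_int[of 0]]) auto
      fix x :: 'a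
      define v where "v = (t * norm x) ^ 2"
      have "v \<ge> 0"
        by (simp add: v_def)
      then have "\<bar>exp (- v) - (1 - v)\<bar> \<le> v ^ 2 / 2"
        using exp_minus_taylor_bound[of v 1] by (simp add: power2_eq_square)
      then have "\<bar>exp (- v) - (1 - v)\<bar> \<le> v ^ 2"
        using zero_le_power2[of v] by linarith
      then have "\<bar>exp (- v) - (1 - v)\<bar> * exp (- u x) \<le> v ^ 2 * exp (- u x)"
        by (intro mult_right_mono) auto
      moreover have "exp (- ((t * norm x) ^ 2)) * exp (- u x) -
          (norm x ^ 0 * exp (- u x) - t ^ 2 * (norm x ^ 2 * exp (- u x))) = (exp (- v) - (1 - v)) * exp (- u x)"
        by (simp add: v_def power_mult_distrib algebra_simps)
      moreover have "t ^ 4 * (norm x ^ 4 * exp (- u x)) = v ^ 2 * exp (- u x)"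
        by (simp add: v_def power_mult_distrib flip: power_mult)
      ultimately show "\<bar>exp (- ((t * norm x) ^ 2)) * exp (- u x) -
          (norm x ^ 0 * exp (- u x) - t ^ 2 * (norm x ^ 2 * exp (- u x)))\<bar> \<le> t ^ 4 * (norm x ^ 4 * exp (- u x))"
        by (simp only: abs_mult abs_exp_cancel)
    qed
    moreover have "(LINT x|M. norm x ^ 0 * exp (- u x) - t ^ 2 * (norm x ^ 2 * exp (- u x))) =
        G 0 - s powr (2 / a) * G 2"
      using G_int[of 0] G_int[of 2] by (simp add: G_def t(4))
    moreover have "(LINT x|M. t ^ 4 * (norm x ^ 4 * exp (- u x))) = s powr (4 / a) * G 4"
      by (simp add: G_def t(5))
    ultimately show ?thesis
      by simp
  qed
  \<comment> \<open>Subtracting the limit \<open>G 0\<close> leaves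
    \<open>- G 2 * s powr (2 / a)\<close> as leading behaviour of a polynomial in \<open>s\<close>
    itself.\<close>
  define q where "q = (\<Sum>j\<le>J. monom (B j) j) - [:G 0:]"
  have q: "poly q s = (\<Sum>j\<le>J. B j * s ^ j) - G 0" for s
    by (simp add: q_def poly_sum poly_monom)
  have bound: "norm (poly q s / s powr (2 / a) - (- G 2)) \<le>
      B' * (s ^ Suc J / s powr (2 / a)) + G 4 * s powr (2 / a)" if s: "s > 0" for s
  proof -
    have "\<bar>poly q s + s powr (2 / a) * G 2\<bar> \<le> s ^ Suc J * B' + s powr (4 / a) * G 4"
      unfolding q using moments[OF s] gauss_approx[OF s] by linarith
    then have "\<bar>(poly q s + s powr (2 / a) * G 2) / s powr (2 / a)\<bar> \<le>
        (s ^ Suc J * B' + s powr (4 / a) * G 4) / s powr (2 / a)"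
      by (simp add: divide_right_mono)
    moreover have "s powr (4 / a) = s powr (2 / a) * s powr (2 / a)"
      by (simp flip: powr_add)
    ultimately show ?thesis
      using s by (simp add: add_divide_distrib mult_ac)
  qed
  have "((\<lambda>s. poly q s / s powr (2 / a) - (- G 2)) \<longlongrightarrow> 0) (at_right 0)"
  proof (rule Lim_null_comparison)
    show "\<forall>\<^sub>F s in at_right 0. norm (poly q s / s powr (2 / a) - (- G 2)) \<le>
        B' * (s ^ Suc J / s powr (2 / a)) + G 4 * s powr (2 / a)"
      using eventually_at_right_less[of 0] by eventually_elim (rule bound)
    have "((\<lambda>s::real. s powr (real (Suc J) - 2 / a)) \<longlongrightarrow> 0) (at_right 0)"
      using J by real_asymp
    moreover have "\<forall>\<^sub>F s in at_right (0::real). s powr (real (Suc J) - 2 / a) = s ^ Suc J / s powr (2 / a)"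
      using eventually_at_right_less[of 0]
      by eventually_elim (simp only: powr_diff powr_realpow)
    ultimately have 1: "((\<lambda>s::real. s ^ Suc J / s powr (2 / a)) \<longlongrightarrow> 0) (at_right 0)"
      by (rule Lim_transform_eventually)
    have 2: "((\<lambda>s::real. s powr (2 / a)) \<longlongrightarrow> 0) (at_right 0)"
      using a by real_asymp
    have "((\<lambda>s. B' * (s ^ Suc J / s powr (2 / a)) + G 4 * s powr (2 / a)) \<longlongrightarrow> B' * 0 + G 4 * 0) (at_right 0)"
      by (intro tendsto_intros 1 2)
    then show "((\<lambda>s. B' * (s ^ Suc J / s powr (2 / a)) + G 4 * s powr (2 / a)) \<longlongrightarrow> 0) (at_right 0)"
      by simp
  qed
  then have "((\<lambda>s. poly q s / s powr (2 / a)) \<longlongrightarrow> - G 2) (at_right 0)"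
    by (rule LIM_zero_cancel)
  then show ?thesis
    by (rule exponent_Nats_if_poly_over_powr_tendsto) (use \<open>G 2 > 0\<close> in simp)
qed

end

section \<open>The generalized Fourier transform\<close>

text \<open>Constants are the harmonic polynomials of degree 0; \<open>p = 1\<close> gives the
  radial eigenfunctions.\<close>

lemma dunkl_laplacian_const: "dunkl_laplacian \<Omega> \<kappa> (\<lambda>_. c) x = 0"
proof -
  have "dunkl \<Omega> \<kappa> e (\<lambda>_. d) = (\<lambda>_. 0)" for e d
    by (auto simp: fun_eq_iff dunkl_def dunkl_quotient_def intro!: sum.neutral)
  then show ?thesis
    by (simp add: dunkl_laplacian_def)
qed

lemma exp_minus_i_pi_nat: "exp (- \<i> * of_real (pi * real l)) = (-1) ^ l"
proof -
  have "exp (- \<i> * of_real (pi * real l)) = exp (of_nat l * (- (\<i> * of_real pi)))"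
    by (simp add: mult_ac)
  also have "\<dots> = exp (- (\<i> * of_real pi)) ^ l"
    by (rule exp_of_nat_mult)
  also have "exp (- (\<i> * of_real pi)) = - 1"
    by (simp add: exp_minus)
  finally show ?thesis .
qed

text \<open>By unitarity, \<open>F f\<close> pairs with \<open>F \<Phi> = (-1) ^ l * \<Phi>\<close>
  as \<open>f\<close> does with \<open>\<Phi>\<close>. So the Laguerre coefficients of
  \<open>F f\<close> are those of \<open>f\<close> with alternating signs, and as
  \<open>\<Phi>\<close> and the eigenvalue are real this passes to \<open>Re (F f)\<close>. The
  exponent is \<open>- \<nu> - 1\<close> rewritten.\<close>

lemma gen_fourier_inversion:
  fixes \<Omega> :: "'a::euclidean_space set" and \<kappa> :: "'a \<Rightarrow> real" and a :: real
    and F :: "('a \<Rightarrow> complex) \<Rightarrow> 'a \<Rightarrow> complex"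
  defines "M \<equiv> mu \<Omega> \<kappa> a"
  assumes a: "a > 0" and b: "2 * lambda \<Omega> \<kappa> + a > 0"
    and F: "gen_fourier_transform \<Omega> \<kappa> a F"
    and sets_M: "sets M = sets borel"
    and exp_int: "\<And>s. s > 0 \<Longrightarrow> integrable M (\<lambda>x. exp (- s * (norm x powr a / a)))"
    and f_meas: "f \<in> borel_measurable borel" and f_sq: "integrable M (\<lambda>x. (f x)\<^sup>2)"
    and s: "s > 0"
  shows "integrable M (\<lambda>x. Re (F (\<lambda>x. of_real (f x)) x) * exp (- s * (norm x powr a / a)))" (is ?int)
    and "(LINT x|M. Re (F (\<lambda>x. of_real (f x)) x) * exp (- s * (norm x powr a / a))) =
      s powr (- (2 * lambda \<Omega> \<kappa> + a) / a) * (LINT x|M. f x * exp (- (1 / s) * (norm x powr a / a)))"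
      (is ?inv)
proof -
  define \<nu> where "\<nu> = 2 * lambda \<Omega> \<kappa> / a"
  have \<nu>: "\<nu> > - 1"
    using a b by (simp add: \<nu>_def field_simps)
  define u where "u x = norm x powr a / a" for x :: 'a
  have u_nonneg: "u x \<ge> 0" for x
    using a by (simp add: u_def)
  have u_borel [measurable]: "u \<in> borel_measurable borel"
    unfolding u_def by measurable
  have u_meas [measurable]: "u \<in> borel_measurable M"
    using u_borel by (simp add: measurable_def sets_M space_borel sets_eq_imp_space_eq[OF sets_M])
  have f_meas' [measurable]: "f \<in> borel_measurable M"
    using f_meas by (simp add: measurable_def sets_M space_borel sets_eq_imp_space_eq[OF sets_M])
  let ?f = "\<lambda>x. complex_of_real (f x)"
  have unitary: "unitary_operator M F"
    using F by (simp add: gen_fourier_transform_def M_def)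
  have f_L2: "?f \<in> L2 M"
    using f_sq f_meas' by (simp add: L2_def)
  have Ff_L2: "F ?f \<in> L2 M"
    using unitary f_L2 by (simp add: unitary_operator_def)
  define g where "g x = Re (F ?f x)" for x
  have [measurable]: "F ?f \<in> borel_measurable M"
    using Ff_L2 by (simp add: L2_def)
  have g_meas [measurable]: "g \<in> borel_measurable M"
    unfolding g_def by measurable
  have g_sq: "integrable M (\<lambda>x. (g x)\<^sup>2)"
  proof (rule Bochner_Integration.integrable_bound)
    show "integrable M (\<lambda>x. (cmod (F ?f x))\<^sup>2)"
      using Ff_L2 by (simp add: L2_def)
    show "AE x in M. norm ((g x)\<^sup>2) \<le> norm ((cmod (F ?f x))\<^sup>2)"
      by (simp add: g_def cmod_power2)
  qed measurable
  \<comment> \<open>\<open>F f\<close> is known only to be square integrable; it becomes integrable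
    against \<open>exp (- s * u)\<close> because that factor is square integrable too.\<close>
  have prod_int: "integrable M (\<lambda>x. h x * k x)"
    if "integrable M (\<lambda>x. (h x)\<^sup>2)" "integrable M (\<lambda>x. (k x)\<^sup>2)"
      and [measurable]: "h \<in> borel_measurable M" "k \<in> borel_measurable M" for h k :: "'a \<Rightarrow> real"
  proof (rule Bochner_Integration.integrable_bound[OF Bochner_Integration.integrable_add[OF that(1,2)]])
    have "\<bar>h x * k x\<bar> \<le> (h x)\<^sup>2 + (k x)\<^sup>2" for x
    proof -
      have "2 * (\<bar>h x\<bar> * \<bar>k x\<bar>) \<le> (h x)\<^sup>2 + (k x)\<^sup>2"
        using sum_squares_bound[of "\<bar>h x\<bar>" "\<bar>k x\<bar>"] by (simp add: mult.assoc)
      moreover have "0 \<le> \<bar>h x\<bar> * \<bar>k x\<bar>"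
        by simp
      ultimately show ?thesis
        unfolding abs_mult by linarith
    qed
    then show "AE x in M. norm (h x * k x) \<le> norm ((h x)\<^sup>2 + (k x)\<^sup>2)"
      by (intro AE_I2) simp
  qed measurable
  have exp_sq: "integrable M (\<lambda>x. (exp (- s * u x))\<^sup>2)" if "s > 0" for s
    using exp_int[of "2 * s"] that by (simp add: u_def mult_ac flip: exp_double)
  have f_int: "integrable M (\<lambda>x. f x * exp (- s * u x))" if "s > 0" for s
    by (intro prod_int f_sq exp_sq that) measurable
  have g_int: "integrable M (\<lambda>x. g x * exp (- s * u x))" if "s > 0" for s
    by (intro prod_int g_sq exp_sq that) measurable
  have coeff: "(LINT x|M. g x * (laguerre l \<nu> (2 * u x) * exp (- u x))) =
      (-1) ^ l * (LINT x|M. f x * (laguerre l \<nu> (2 * u x) * exp (- u x)))" for l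
  proof -
    define \<phi> where "\<phi> x = laguerre l \<nu> (2 * u x) * exp (- u x)" for x
    have [measurable]: "\<phi> \<in> borel_measurable M"
      unfolding \<phi>_def by measurable
    have \<phi>_sq: "integrable M (\<lambda>x. (\<phi> x)\<^sup>2)"
    proof (rule Bochner_Integration.integrable_bound)
      \<comment> \<open>The Laguerre majorant at \<open>z = 1 / 4\<close> allows growth
        \<open>exp (2 / 3 * u)\<close>, so \<open>exp (- (1 / 3) * u)\<close> is left; the choice of
        1/4 only has to stay below 1/3.\<close>
      define c :: real where "c = 4 ^ l * (3 / 4) powr (- \<nu> - 1)"
      show "integrable M (\<lambda>x. c\<^sup>2 * (exp (- (1 / 3) * u x))\<^sup>2)"
        by (intro integrable_mult_right exp_sq) simp
      have "\<bar>\<phi> x\<bar> \<le> c * exp (- (1 / 3) * u x)" for x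
      proof -
        have "\<bar>laguerre l \<nu> (2 * u x)\<bar> * (1 / 4) ^ l \<le> (\<Sum>i<Suc l. \<bar>laguerre i \<nu> (2 * u x)\<bar> * (1 / 4) ^ i)"
          by (simp add: sum_nonneg)
        also have "\<dots> \<le> (3 / 4) powr (- \<nu> - 1) * exp (\<bar>2 * u x\<bar> * (1 / 4) / (3 / 4))"
          using sum_abs_laguerre_le[OF \<nu>, of "1 / 4" "2 * u x" "Suc l"] by simp
        finally have "\<bar>laguerre l \<nu> (2 * u x)\<bar> \<le> c * exp (2 / 3 * u x)"
          using u_nonneg[of x] by (simp add: c_def power_divide field_simps)
        then have "\<bar>\<phi> x\<bar> \<le> c * exp (2 / 3 * u x) * exp (- u x)"
          by (simp add: \<phi>_def abs_mult mult_right_mono)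
        also have "\<dots> = c * exp (- (1 / 3) * u x)"
          by (simp add: mult.assoc flip: exp_add)
        finally show ?thesis .
      qed
      then have "\<bar>\<phi> x\<bar>\<^sup>2 \<le> (c * exp (- (1 / 3) * u x))\<^sup>2" for x
        by (intro power_mono) auto
      then show "AE x in M. norm ((\<phi> x)\<^sup>2) \<le> norm (c\<^sup>2 * (exp (- (1 / 3) * u x))\<^sup>2)"
        by (intro AE_I2) (simp add: power_mult_distrib)
    qed measurable
    define \<Phi> where "\<Phi> = Phi \<Omega> \<kappa> a l 0 (\<lambda>_. 1)"
    have \<Phi>: "\<Phi> = (\<lambda>x. complex_of_real (\<phi> x))"
      by (auto simp: \<Phi>_def Phi_def fun_eq_iff \<phi>_def \<nu>_def u_def)
    have \<Phi>_L2: "\<Phi> \<in> L2 M"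
      using \<phi>_sq by (simp add: L2_def \<Phi>)
    have "homogeneous_polynomial 0 (\<lambda>_::'a. 1)"
      by (simp add: homogeneous_polynomial_def)
    then have "AE x in M. F \<Phi> x = exp (- \<i> * of_real (pi * (real l + real 0 / a))) * \<Phi> x"
      using F dunkl_laplacian_const[of \<Omega> \<kappa> 1] unfolding gen_fourier_transform_def M_def \<Phi>_def by blast
    then have F\<Phi>: "AE x in M. F \<Phi> x = (-1) ^ l * \<Phi> x"
      using exp_minus_i_pi_nat[of l] by simp
    have "F \<Phi> \<in> L2 M"
      using unitary \<Phi>_L2 by (simp add: unitary_operator_def)
    then have [measurable]: "F \<Phi> \<in> borel_measurable M" "\<Phi> \<in> borel_measurable M"
      using \<Phi>_L2 by (auto simp: L2_def)
    have int: "integrable M (\<lambda>x. F ?f x * of_real (\<phi> x))"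
    proof (rule Bochner_Integration.integrable_bound)
      show "integrable M (\<lambda>x. cmod (F ?f x) * \<phi> x)"
        using Ff_L2 \<phi>_sq by (intro prod_int) (auto simp: L2_def)
    qed (auto simp: norm_mult)
    have "(LINT x|M. F ?f x * cnj (F \<Phi> x)) = (LINT x|M. ?f x * cnj (\<Phi> x))"
      using unitary f_L2 \<Phi>_L2 unfolding unitary_operator_def by blast
    also have "(LINT x|M. F ?f x * cnj (F \<Phi> x)) = (LINT x|M. (-1) ^ l * (F ?f x * of_real (\<phi> x)))"
    proof (rule integral_cong_AE)
      show "AE x in M. F ?f x * cnj (F \<Phi> x) = (-1) ^ l * (F ?f x * of_real (\<phi> x))"
        using F\<Phi> by eventually_elim (simp add: \<Phi>)
      have [measurable]: "cnj \<in> borel_measurable borel"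
        by (intro borel_measurable_continuous_onI continuous_intros)
      show "(\<lambda>x. F ?f x * cnj (F \<Phi> x)) \<in> borel_measurable M"
        by measurable
      show "(\<lambda>x. (-1) ^ l * (F ?f x * of_real (\<phi> x))) \<in> borel_measurable M"
        using int by (intro borel_measurable_times) auto
    qed
    also have "\<dots> = (-1) ^ l * (LINT x|M. F ?f x * of_real (\<phi> x))"
      by simp
    also have "(LINT x|M. ?f x * cnj (\<Phi> x)) = of_real (LINT x|M. f x * \<phi> x)"
      unfolding \<Phi> by (simp flip: of_real_mult)
    finally have "(LINT x|M. F ?f x * of_real (\<phi> x)) = (-1) ^ l * of_real (LINT x|M. f x * \<phi> x)"
      by (metis (no_types, lifting) minus_one_mult_self mult.assoc mult_1)
    then have "Re (LINT x|M. F ?f x * of_real (\<phi> x)) = Re (of_real ((-1) ^ l * (LINT x|M. f x * \<phi> x)))"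
      by simp
    moreover have "Re (LINT x|M. F ?f x * of_real (\<phi> x)) = (LINT x|M. g x * \<phi> x)"
      using integral_Re[OF int] by (simp add: g_def)
    ultimately show ?thesis
      by (simp add: \<phi>_def)
  qed
  show ?int
    using g_int[OF s] by (simp add: g_def u_def)
  have "- (2 * lambda \<Omega> \<kappa> + a) / a = - \<nu> - 1"
    using a by (simp add: \<nu>_def field_simps)
  then show ?inv
    using laplace_transform_inversion_if_laguerre[OF \<nu> f_meas' g_meas u_meas u_nonneg f_int g_int coeff s]
    by (simp only: g_def u_def)
qed

theorem proposition5p2:
  fixes \<Omega> :: "(real ^ 'd) set"
    and \<kappa> :: "real ^ 'd \<Rightarrow> real"
    and a :: real
    and F :: "(real ^ 'd \<Rightarrow> complex) \<Rightarrow> real ^ 'd \<Rightarrow> complex"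
  assumes "a > 0"
    and "root_system \<Omega>"
    and "multiplicity_function \<Omega> \<kappa>"
    and "2 * lambda \<Omega> \<kappa> + a > 0"
    and "gen_fourier_transform \<Omega> \<kappa> a F"
  shows "((\<forall>f\<in>schwartz. \<exists>h. (AE y in mu \<Omega> \<kappa> a. F f y = h y) \<and> smooth h) \<longrightarrow> a / 2 \<in> \<nat>) \<and>
         ((\<forall>f\<in>schwartz. \<exists>h. (AE y in mu \<Omega> \<kappa> a. F f y = h y) \<and> rapidly_decreasing h)
            \<longrightarrow> 2 / a \<in> \<nat>)"
proof -
  define b where "b = 2 * lambda \<Omega> \<kappa> + a"
  have a: "a > 0"
    by fact
  have exp_int: "integrable (homogeneous_weight.M w) (\<lambda>x. exp (- s * (norm x powr a / a)))"
    if "homogeneous_weight w b" "s > 0" for w :: "real ^ 'd \<Rightarrow> real" and s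
    by (rule homogeneous_weight.integrable_exp_decay[OF that(1) _ a, of _ "s / a" 1 0])
       (use that(2) a in auto)
  \<comment> \<open>A divergent normalizing integral would be 0 by convention, and
    \<open>norm_const\<close> with it. Its finiteness and positivity therefore come first, from the
    weight with constant 1.\<close>
  have c: "norm_const \<Omega> \<kappa> a > 0"
  proof -
    interpret W: homogeneous_weight "\<lambda>x. 1 * weight \<Omega> \<kappa> a x" b
      unfolding b_def using assms by (intro homogeneous_weight_weight) auto
    have "0 < (LINT x|W.M. exp (- 1 * (norm x powr a / a)))"
      by (intro W.integral_pos exp_int W.homogeneous_weight_axioms) auto
    also have "\<dots> = (LINT x|lborel. weight \<Omega> \<kappa> a x * exp (- 1 * (norm x powr a / a)))"
      unfolding W.M_def using W.w_nonneg by (subst integral_density) (use W.w_measurable in auto)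
    finally show ?thesis
      by (simp add: norm_const_def mult.commute)
  qed
  interpret W: homogeneous_weight "\<lambda>x. norm_const \<Omega> \<kappa> a * weight \<Omega> \<kappa> a x" b
    unfolding b_def using assms c by (intro homogeneous_weight_weight) auto
  have mu: "mu \<Omega> \<kappa> a = W.M"
    by (simp add: mu_def W.M_def)
  have gauss_meas: "gaussian \<in> borel_measurable (borel :: (real ^ 'd) measure)"
    unfolding gaussian_def by measurable
  have gauss_sq: "integrable W.M (\<lambda>x. (gaussian x)\<^sup>2)"
    by (rule W.integrable_exp_decay[of _ 2 2 1 0])
       (use gauss_meas in \<open>auto simp: gaussian_def simp flip: exp_double\<close>)
  let ?f = "\<lambda>x::real ^ 'd. complex_of_real (gaussian x)"
  define g where "g x = Re (F ?f x)" for x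
  note inv = gen_fourier_inversion[OF a assms(4,5), folded b_def, unfolded mu,
      OF W.sets_M exp_int[OF W.homogeneous_weight_axioms] gauss_meas gauss_sq, folded g_def]
  have "?f \<in> L2 W.M"
    using gauss_sq gauss_meas by (simp add: L2_def)
  then have "F ?f \<in> L2 W.M"
    using assms(5) by (simp add: gen_fourier_transform_def unitary_operator_def mu)
  then have Ff [measurable]: "F ?f \<in> borel_measurable borel"
      and Ff_sq: "integrable W.M (\<lambda>x. (cmod (F ?f x))\<^sup>2)"
    by (auto simp: L2_def)
  have g_meas [measurable]: "g \<in> borel_measurable borel"
    unfolding g_def by measurable
  have g_sq: "integrable W.M (\<lambda>x. (g x)\<^sup>2)"
    by (rule Bochner_Integration.integrable_bound[OF Ff_sq])
       (simp_all add: g_def cmod_power2)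
  show ?thesis
  proof (intro conjI impI)
    assume "\<forall>f\<in>schwartz. \<exists>h. (AE y in mu \<Omega> \<kappa> a. F f y = h y) \<and> smooth h"
    then obtain h where h: "AE y in W.M. F ?f y = h y" "smooth h"
      using gaussian_schwartz unfolding mu by blast
    have "AE x in W.M. g x = Re (h x)"
      using h(1) by eventually_elim (simp add: g_def)
    then show "a / 2 \<in> \<nat>"
      using W.half_exponent_Nats_if_smooth[OF a h(2) _ g_meas inv] by blast
  next
    assume "\<forall>f\<in>schwartz. \<exists>h. (AE y in mu \<Omega> \<kappa> a. F f y = h y) \<and> rapidly_decreasing h"
    then obtain h where h: "AE y in W.M. F ?f y = h y" "rapidly_decreasing h"
      using gaussian_schwartz unfolding mu by blast
    have "AE x in W.M. \<bar>g x\<bar> \<le> norm (h x)"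
      using h(1) by eventually_elim (simp add: g_def abs_Re_le_cmod)
    then show "2 / a \<in> \<nat>"
      using W.reciprocal_exponent_Nats_if_rapidly_decreasing[OF a h(2) _ g_meas g_sq inv(2)] by blast
  qed
qed

end
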